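(* Let $\Delta$ be a simplicial complex on the vertex set $\{1,\dots,n\}$. Then the fundamental groupoid $\Pi_1(\mathbb{R}^\bullet[\Delta])$ of the real punctured spectrum of the Stanley-Reisner ring of $\Delta$ is equivalent to the following groupoid. Its objects are the pairs $(F,\sigma)$ where $F$ is a facet of $\Delta$ and $\sigma=\sigma_F:F\to\{+,-\}$ is a function. Its isomorphisms are generated by isomorphisms $$\alpha_{i,[\sigma_F,\tau_G]}:(F,\sigma)\to(G,\tau),$$ one whenever $i\in F\cap G$ with $\sigma(i)=\tau(i)$, subject to the relations generated by: (R1) for each fixed $i\in\{1,\dots,n\}$, $\alpha_{i,[\sigma_F,\rho_H]}=\alpha_{i,[\tau_G,\rho_H]}\circ\alpha_{i,[\sigma_F,\tau_G]}$ (whenever these are defined); (R2) for every $\{i,j\}\subseteq F\cap G$ with $\sigma(i)=\tau(i)$ and $\sigma(j)=\tau(j)$, $$\beta_{i,[\sigma_F,\tau_G]}=\beta_{j,[\sigma_F,\tau_G]}:(F,\sigma)\to(G,\tau),$$ where $\beta_{i,[\sigma_F,\tau_G]}$ (respectively $\beta_{j,[\sigma_F,\tau_G]}$) denotes a concatenation of generators $\alpha_{i,[\cdot,\cdot]}$ with first index $i$ (respectively $j$) leading from $(F,\sigma)$ to $(G,\tau)$.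
   Context: A simplicial complex on $\{1,\dots,n\}$ is a collection of finite nonempty subsets (faces) containing all singletons and closed under passing to nonempty subsets; facets are the maximal faces. A binoid is a commutative monoid (written multiplicatively) with an absorbing element $0$; homomorphisms preserve products, $1$ and $0$. The binoid of $\Delta$ is $M_\Delta=\{X_1^{r_1}\cdots X_n^{r_n}\}\cup\{0\}$ with $\prod_{i\in I}X_i=0$ for all nonfaces $I$; its binoid algebra is the Stanley-Reisner ring of $\Delta$. $\mathbb{R}\mathrm{Spec}(M_\Delta)=\mathrm{Hom}(M_\Delta,(\mathbb{R},\cdot))$ is the set of binoid homomorphisms, viewed as a subspace of $\mathbb{R}^n$ by evaluation at $X_1,\dots,X_n$; it is the set of $x\in\mathbb{R}^n$ with $\prod_{i\in I}x_i=0$ for all nonfaces $I$. The real punctured spectrum $\mathbb{R}^\bullet[\Delta]$ is the space of real points of the punctured spectrum of $M_\Delta$ (the scheme of $M_\Delta$ minus its closed point), i.e. the union of the open subsets $\{x\in\mathbb{R}\mathrm{Spec}(M_\Delta): x_i\neq0\}$, $i=1,\dots,n$. $\Pi_1$ denotes the fundamental groupoid (objects: points; morphisms: homotopy classes of paths relative to endpoints), considered up to equivalence of categories. *)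

theory Defs
  imports "HOL-Analysis.Analysis" "HOL-Algebra.Group"
begin

section \<open>Simplicial complexes\<close>

text \<open>Faces are nonempty, so the empty set is neither a face nor a nonface below.\<close>

definition abstract_simplicial_complex :: "'v set \<Rightarrow> 'v set set \<Rightarrow> bool" where
  "abstract_simplicial_complex V \<Delta> \<longleftrightarrow>
     (\<forall>F\<in>\<Delta>. finite F \<and> F \<noteq> {} \<and> F \<subseteq> V) \<and>
     (\<forall>v\<in>V. {v} \<in> \<Delta>) \<and>
     (\<forall>F\<in>\<Delta>. \<forall>G. G \<noteq> {} \<and> G \<subseteq> F \<longrightarrow> G \<in> \<Delta>)"

definition facets :: "'v set set \<Rightarrow> 'v set set" where
  "facets \<Delta> = {F \<in> \<Delta>. \<forall>G\<in>\<Delta>. F \<subseteq> G \<longrightarrow> G = F}"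

section \<open>Binoids and the real punctured spectrum\<close>

record 'a binoid = "'a monoid" +
  absorb :: 'a

locale binoid = comm_monoid M for M (structure) +
  assumes absorb_closed: "absorb M \<in> carrier M"
    and absorb_mult: "x \<in> carrier M \<Longrightarrow> absorb M \<otimes> x = absorb M"

definition binoid_hom :: "('a, 'm) binoid_scheme \<Rightarrow> ('b, 'k) binoid_scheme \<Rightarrow> ('a \<Rightarrow> 'b) set" where
  "binoid_hom M N = {\<phi> \<in> hom M N. \<phi> \<one>\<^bsub>M\<^esub> = \<one>\<^bsub>N\<^esub> \<and> \<phi> (absorb M) = absorb N}"

definition real_binoid :: "real binoid" where
  "real_binoid = \<lparr>carrier = UNIV, monoid.mult = (*), one = 1, absorb = 0\<rparr>"

text \<open>
  The monomial with exponent vector \<open>r\<close> is \<open>Some r\<close>, and \<open>None\<close> is the absorbing element.  A monomial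
  vanishes in the binoid of \<open>\<Delta>\<close> iff it is divisible by the product of the variables of a
  nonface, that is, iff its support is a nonface.
\<close>

definition sr_monomial :: "'v set set \<Rightarrow> ('v \<Rightarrow> nat) \<Rightarrow> ('v \<Rightarrow> nat) option" where
  "sr_monomial \<Delta> r = (if {i. r i \<noteq> 0} \<in> insert {} \<Delta> then Some r else None)"

definition sr_binoid :: "'v set set \<Rightarrow> ('v \<Rightarrow> nat) option binoid" where
  "sr_binoid \<Delta> =
     \<lparr>carrier = insert None {Some r | r. {i. r i \<noteq> 0} \<in> insert {} \<Delta>},
      monoid.mult = (\<lambda>a b. case (a, b) of
         (Some r, Some s) \<Rightarrow> sr_monomial \<Delta> (\<lambda>i. r i + s i) | _ \<Rightarrow> None),
      one = Some (\<lambda>_. 0),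
      absorb = None\<rparr>"

definition sr_var :: "'v set set \<Rightarrow> 'v \<Rightarrow> ('v \<Rightarrow> nat) option" where
  "sr_var \<Delta> i = sr_monomial \<Delta> (\<lambda>j. if j = i then 1 else 0)"

definition real_spectrum :: "'n::finite set set \<Rightarrow> (real ^ 'n) set" where
  "real_spectrum \<Delta> =
     (\<lambda>\<phi>. \<chi> i. \<phi> (sr_var \<Delta> i)) ` binoid_hom (sr_binoid \<Delta>) real_binoid"

definition real_punctured_spectrum :: "'n::finite set set \<Rightarrow> (real ^ 'n) set" where
  "real_punctured_spectrum \<Delta> = (\<Union>i. {x \<in> real_spectrum \<Delta>. x $ i \<noteq> 0})"

section \<open>Groupoids and their equivalence\<close>

text \<open>
  \<open>Comp C x y z g f\<close> is the composite \<open>g \<circ> f\<close> of \<open>f : x \<rightarrow> y\<close> and \<open>g : y \<rightarrow> z\<close>.  Hom sets for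
  different pairs of objects are not required to be disjoint.
\<close>

record ('o, 'm) category =
  Obj :: "'o set"
  Hom :: "'o \<Rightarrow> 'o \<Rightarrow> 'm set"
  Ident :: "'o \<Rightarrow> 'm"
  Comp :: "'o \<Rightarrow> 'o \<Rightarrow> 'o \<Rightarrow> 'm \<Rightarrow> 'm \<Rightarrow> 'm"

locale category =
  fixes C :: "('o, 'm) category"
  assumes ident_in: "x \<in> Obj C \<Longrightarrow> Ident C x \<in> Hom C x x"
    and comp_in: "\<lbrakk>x \<in> Obj C; y \<in> Obj C; z \<in> Obj C; f \<in> Hom C x y; g \<in> Hom C y z\<rbrakk>
      \<Longrightarrow> Comp C x y z g f \<in> Hom C x z"
    and ident_left: "\<lbrakk>x \<in> Obj C; y \<in> Obj C; f \<in> Hom C x y\<rbrakk> \<Longrightarrow> Comp C x y y (Ident C y) f = f"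
    and ident_right: "\<lbrakk>x \<in> Obj C; y \<in> Obj C; f \<in> Hom C x y\<rbrakk> \<Longrightarrow> Comp C x x y f (Ident C x) = f"
    and comp_assoc: "\<lbrakk>w \<in> Obj C; x \<in> Obj C; y \<in> Obj C; z \<in> Obj C;
        f \<in> Hom C w x; g \<in> Hom C x y; h \<in> Hom C y z\<rbrakk>
      \<Longrightarrow> Comp C w y z h (Comp C w x y g f) = Comp C w x z (Comp C x y z h g) f"

definition isomorphism_in :: "('o, 'm) category \<Rightarrow> 'o \<Rightarrow> 'o \<Rightarrow> 'm \<Rightarrow> bool" where
  "isomorphism_in C x y f \<longleftrightarrow> f \<in> Hom C x y \<and>
     (\<exists>g \<in> Hom C y x. Comp C x y x g f = Ident C x \<and> Comp C y x y f g = Ident C y)"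

locale groupoid = category +
  assumes all_iso: "\<lbrakk>x \<in> Obj C; y \<in> Obj C; f \<in> Hom C x y\<rbrakk> \<Longrightarrow> isomorphism_in C x y f"

text \<open>A functor is given by its object map and its maps on the individual hom sets.\<close>

type_synonym ('o, 'm, 'p, 'k) functor_data = "('o \<Rightarrow> 'p) \<times> ('o \<Rightarrow> 'o \<Rightarrow> 'm \<Rightarrow> 'k)"

definition is_functor ::
  "('o, 'm) category \<Rightarrow> ('p, 'k) category \<Rightarrow> ('o, 'm, 'p, 'k) functor_data \<Rightarrow> bool" where
  "is_functor C D F \<longleftrightarrow>
     (\<forall>x \<in> Obj C. fst F x \<in> Obj D) \<and>
     (\<forall>x \<in> Obj C. \<forall>y \<in> Obj C. \<forall>f \<in> Hom C x y. snd F x y f \<in> Hom D (fst F x) (fst F y)) \<and>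
     (\<forall>x \<in> Obj C. snd F x x (Ident C x) = Ident D (fst F x)) \<and>
     (\<forall>x \<in> Obj C. \<forall>y \<in> Obj C. \<forall>z \<in> Obj C. \<forall>f \<in> Hom C x y. \<forall>g \<in> Hom C y z.
        snd F x z (Comp C x y z g f)
          = Comp D (fst F x) (fst F y) (fst F z) (snd F y z g) (snd F x y f))"

definition id_functor :: "('o, 'm, 'o, 'm) functor_data" where
  "id_functor = (\<lambda>x. x, \<lambda>x y f. f)"

definition comp_functor ::
  "('p, 'k, 'q, 'l) functor_data \<Rightarrow> ('o, 'm, 'p, 'k) functor_data \<Rightarrow> ('o, 'm, 'q, 'l) functor_data"
where
  "comp_functor G F =
     (\<lambda>x. fst G (fst F x), \<lambda>x y f. snd G (fst F x) (fst F y) (snd F x y f))"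

definition naturally_isomorphic :: "('o, 'm) category \<Rightarrow> ('p, 'k) category \<Rightarrow>
    ('o, 'm, 'p, 'k) functor_data \<Rightarrow> ('o, 'm, 'p, 'k) functor_data \<Rightarrow> bool" where
  "naturally_isomorphic C D F G \<longleftrightarrow> (\<exists>\<eta>.
     (\<forall>x \<in> Obj C. isomorphism_in D (fst F x) (fst G x) (\<eta> x)) \<and>
     (\<forall>x \<in> Obj C. \<forall>y \<in> Obj C. \<forall>f \<in> Hom C x y.
        Comp D (fst F x) (fst F y) (fst G y) (\<eta> y) (snd F x y f)
          = Comp D (fst F x) (fst G x) (fst G y) (snd G x y f) (\<eta> x)))"

definition equivalent_groupoids :: "('o, 'm) category \<Rightarrow> ('p, 'k) category \<Rightarrow> bool" where
  "equivalent_groupoids C D \<longleftrightarrow> groupoid C \<and> groupoid D \<and>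
     (\<exists>F G. is_functor C D F \<and> is_functor D C G \<and>
        naturally_isomorphic C C (comp_functor G F) id_functor \<and>
        naturally_isomorphic D D (comp_functor F G) id_functor)"

section \<open>The fundamental groupoid\<close>

definition fundamental_groupoid ::
  "'a::topological_space set \<Rightarrow> ('a, (real \<Rightarrow> 'a) set) category" where
  "fundamental_groupoid S =
     \<lparr>Obj = S,
      Hom = (\<lambda>x y. {{q. homotopic_paths S p q} | p.
               path p \<and> path_image p \<subseteq> S \<and> pathstart p = x \<and> pathfinish p = y}),
      Ident = (\<lambda>x. {q. homotopic_paths S (\<lambda>_. x) q}),
      Comp = (\<lambda>x y z g f. {r. \<exists>p\<in>f. \<exists>q\<in>g. homotopic_paths S (p +++ q) r})\<rparr>"

section \<open>Groupoids given by generators and relations\<close>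

text \<open>
  Generators form a set \<open>E\<close> with source and target maps \<open>s\<close> and \<open>t\<close> into the object set \<open>X\<close>.
  Words in the generators and their formal inverses are written in the order in which they are
  traversed, so that the word \<open>u @ v\<close> stands for the composite \<open>v \<circ> u\<close>.
\<close>

datatype 'e letter = Gen 'e | Inv 'e

inductive walk :: "'o set \<Rightarrow> 'e set \<Rightarrow> ('e \<Rightarrow> 'o) \<Rightarrow> ('e \<Rightarrow> 'o) \<Rightarrow> 'o \<Rightarrow> 'e letter list \<Rightarrow> 'o \<Rightarrow> bool"
  for X E s t where
  walk_Nil: "x \<in> X \<Longrightarrow> walk X E s t x [] x"
| walk_Gen: "\<lbrakk>e \<in> E; s e \<in> X; walk X E s t (t e) w y\<rbrakk> \<Longrightarrow> walk X E s t (s e) (Gen e # w) y"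
| walk_Inv: "\<lbrakk>e \<in> E; t e \<in> X; walk X E s t (s e) w y\<rbrakk> \<Longrightarrow> walk X E s t (t e) (Inv e # w) y"

text \<open>
  \<open>word_eq X E s t R x y\<close> is the congruence on words from \<open>x\<close> to \<open>y\<close> generated by the cancellation of
  inverses and by the relations \<open>R\<close>.  Keeping track of the end points ensures that every
  intermediate word is composable.
\<close>

inductive word_eq :: "'o set \<Rightarrow> 'e set \<Rightarrow> ('e \<Rightarrow> 'o) \<Rightarrow> ('e \<Rightarrow> 'o) \<Rightarrow>
    ('e letter list \<times> 'e letter list) set \<Rightarrow> 'o \<Rightarrow> 'o \<Rightarrow> 'e letter list \<Rightarrow> 'e letter list \<Rightarrow> bool"
  for X E s t R where
  word_rel: "\<lbrakk>(u, v) \<in> R; walk X E s t x u y; walk X E s t x v y\<rbrakk> \<Longrightarrow> word_eq X E s t R x y u v"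
| word_Gen_Inv: "\<lbrakk>e \<in> E; s e \<in> X; t e \<in> X\<rbrakk> \<Longrightarrow> word_eq X E s t R (s e) (s e) [Gen e, Inv e] []"
| word_Inv_Gen: "\<lbrakk>e \<in> E; s e \<in> X; t e \<in> X\<rbrakk> \<Longrightarrow> word_eq X E s t R (t e) (t e) [Inv e, Gen e] []"
| word_refl: "walk X E s t x w y \<Longrightarrow> word_eq X E s t R x y w w"
| word_sym: "word_eq X E s t R x y u v \<Longrightarrow> word_eq X E s t R x y v u"
| word_trans: "\<lbrakk>word_eq X E s t R x y u v; word_eq X E s t R x y v w\<rbrakk>
    \<Longrightarrow> word_eq X E s t R x y u w"
| word_append: "\<lbrakk>word_eq X E s t R x y u u'; word_eq X E s t R y z v v'\<rbrakk>
    \<Longrightarrow> word_eq X E s t R x z (u @ v) (u' @ v')"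

definition presented_groupoid :: "'o set \<Rightarrow> 'e set \<Rightarrow> ('e \<Rightarrow> 'o) \<Rightarrow> ('e \<Rightarrow> 'o) \<Rightarrow>
    ('e letter list \<times> 'e letter list) set \<Rightarrow> ('o, 'e letter list set) category" where
  "presented_groupoid X E s t R =
     \<lparr>Obj = X,
      Hom = (\<lambda>x y. {{v. word_eq X E s t R x y u v} | u. walk X E s t x u y}),
      Ident = (\<lambda>x. {v. word_eq X E s t R x x [] v}),
      Comp = (\<lambda>x y z g f. {w. \<exists>u\<in>f. \<exists>v\<in>g. word_eq X E s t R x z (u @ v) w})\<rparr>"

section \<open>The groupoid of signed facets\<close>

datatype sign_symbol = Plus_sign | Minus_sign

type_synonym 'v signed_facet = "'v set \<times> ('v \<Rightarrow> sign_symbol)"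

definition signed_facets :: "'v set set \<Rightarrow> 'v signed_facet set" where
  "signed_facets \<Delta> = {(F, \<sigma>). F \<in> facets \<Delta> \<and> \<sigma> \<in> F \<rightarrow>\<^sub>E UNIV}"

definition agree_at :: "'v \<Rightarrow> 'v signed_facet \<Rightarrow> 'v signed_facet \<Rightarrow> bool" where
  "agree_at i a b \<longleftrightarrow> i \<in> fst a \<inter> fst b \<and> snd a i = snd b i"

text \<open>The triple \<open>(i, (F, \<sigma>), (G, \<tau>))\<close> represents the generator \<open>\<alpha>\<close> with indices \<open>i\<close> and \<open>[\<sigma>\<^sub>F, \<tau>\<^sub>G]\<close>.\<close>

type_synonym 'v facet_gen = "'v \<times> 'v signed_facet \<times> 'v signed_facet"

abbreviation gen_index :: "'v facet_gen \<Rightarrow> 'v" where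
  "gen_index \<equiv> fst"

abbreviation gen_source :: "'v facet_gen \<Rightarrow> 'v signed_facet" where
  "gen_source e \<equiv> fst (snd e)"

abbreviation gen_target :: "'v facet_gen \<Rightarrow> 'v signed_facet" where
  "gen_target e \<equiv> snd (snd e)"

definition facet_gens :: "'v set set \<Rightarrow> 'v facet_gen set" where
  "facet_gens \<Delta> =
     {(i, a, b). a \<in> signed_facets \<Delta> \<and> b \<in> signed_facets \<Delta> \<and> agree_at i a b}"

definition facet_rel1 :: "'v set set \<Rightarrow> ('v facet_gen letter list \<times> 'v facet_gen letter list) set" where
  "facet_rel1 \<Delta> = {([Gen (i, a, b), Gen (i, b, c)], [Gen (i, a, c)]) | i a b c.
     (i, a, b) \<in> facet_gens \<Delta> \<and> (i, b, c) \<in> facet_gens \<Delta> \<and> (i, a, c) \<in> facet_gens \<Delta>}"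

text \<open>\<open>index_chain \<Delta> i a b u\<close>: \<open>u\<close> is a concatenation of generators with first index \<open>i\<close> from \<open>a\<close> to \<open>b\<close>.\<close>

definition index_chain :: "'v set set \<Rightarrow> 'v \<Rightarrow> 'v signed_facet \<Rightarrow> 'v signed_facet \<Rightarrow>
    'v facet_gen letter list \<Rightarrow> bool" where
  "index_chain \<Delta> i a b u \<longleftrightarrow>
     walk (signed_facets \<Delta>) (facet_gens \<Delta>) gen_source gen_target a u b \<and>
     (\<exists>es. es \<noteq> [] \<and> u = map Gen es \<and> (\<forall>e \<in> set es. gen_index e = i))"

definition facet_rel2 :: "'v set set \<Rightarrow> ('v facet_gen letter list \<times> 'v facet_gen letter list) set" where
  "facet_rel2 \<Delta> = {(u, v). \<exists>i j a b.
     a \<in> signed_facets \<Delta> \<and> b \<in> signed_facets \<Delta> \<and> agree_at i a b \<and> agree_at j a b \<and>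
     index_chain \<Delta> i a b u \<and> index_chain \<Delta> j a b v}"

definition facet_groupoid ::
  "'v set set \<Rightarrow> ('v signed_facet, 'v facet_gen letter list set) category" where
  "facet_groupoid \<Delta> =
     presented_groupoid (signed_facets \<Delta>) (facet_gens \<Delta>) gen_source gen_target
       (facet_rel1 \<Delta> \<union> facet_rel2 \<Delta>)"

section \<open>The binoids are binoids, and coordinates of the real spectrum\<close>

lemma binoid_real_binoid: "binoid real_binoid"
  by unfold_locales (auto simp: real_binoid_def Units_def)

lemma binoid_sr_binoid:
  assumes "abstract_simplicial_complex V \<Delta>"
  shows "binoid (sr_binoid \<Delta>)"
proof -
  have down: "G \<in> insert {} \<Delta>" if "F \<in> insert {} \<Delta>" "G \<subseteq> F" for F G
    using assms that unfolding abstract_simplicial_complex_def by blast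
  have [simp]: "sr_monomial \<Delta> (\<lambda>i. r i + (s i + q i)) = None"
    if "sr_monomial \<Delta> (\<lambda>i. r i + s i) = None" for r s q :: "'a \<Rightarrow> nat"
    using that down[of "{i. r i + (s i + q i) \<noteq> 0}" "{i. r i + s i \<noteq> 0}"]
    by (force simp: sr_monomial_def split: if_splits)
  have [simp]: "sr_monomial \<Delta> (\<lambda>i. r i + (s i + q i)) = None"
    if "sr_monomial \<Delta> (\<lambda>i. s i + q i) = None" for r s q :: "'a \<Rightarrow> nat"
    using that down[of "{i. r i + (s i + q i) \<noteq> 0}" "{i. s i + q i \<noteq> 0}"]
    by (force simp: sr_monomial_def split: if_splits)
  have [simp]: "sr_monomial \<Delta> (\<lambda>i. 0) = Some (\<lambda>i. 0)"
    by (simp add: sr_monomial_def)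
  have [simp]: "sr_monomial \<Delta> r = Some r" if "{i. 0 < r i} \<in> \<Delta>" for r :: "'a \<Rightarrow> nat"
    using that by (simp add: sr_monomial_def)
  have supp: "sr_monomial \<Delta> r = Some r" if "Some r \<in> carrier (sr_binoid \<Delta>)" for r
    using that by (simp add: sr_monomial_def sr_binoid_def)
  have some: "sr_monomial \<Delta> r = Some s \<Longrightarrow> s = r" for r s
    by (auto simp: sr_monomial_def split: if_splits)
  show ?thesis
  proof (unfold_locales, goal_cases)
    case (1 x y)
    then show ?case
      by (auto simp: sr_binoid_def sr_monomial_def split: option.splits)
  next
    case (2 x y z)
    then show ?case
      by (auto simp: sr_binoid_def add.assoc split: option.splits dest!: some)
  next
    case 3
    then show ?case by (simp add: sr_binoid_def)
  next
    case (4 x)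
    with supp show ?case
      by (cases x) (simp_all add: sr_binoid_def)
  next
    case (5 x)
    with supp show ?case
      by (cases x) (simp_all add: sr_binoid_def)
  next
    case (6 x y)
    then show ?case by (auto simp: sr_binoid_def add.commute split: option.splits)
  qed (auto simp: sr_binoid_def)
qed

lemma real_spectrum_eq:
  fixes \<Delta> :: "'n::finite set set"
  assumes "abstract_simplicial_complex UNIV \<Delta>"
  shows "real_spectrum \<Delta> = {x. \<forall>I. I \<noteq> {} \<and> I \<notin> \<Delta> \<longrightarrow> (\<Prod>i\<in>I. x $ i) = 0}"
proof (intro equalityI subsetI CollectI allI impI)
  fix x I assume x: "x \<in> real_spectrum \<Delta>" and I: "I \<noteq> {} \<and> I \<notin> \<Delta>"
  then obtain \<phi> where \<phi>: "\<phi> \<in> binoid_hom (sr_binoid \<Delta>) real_binoid"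
    and x\<phi>: "\<And>i. x $ i = \<phi> (sr_var \<Delta> i)"
    unfolding real_spectrum_def by (metis (no_types, lifting) imageE vec_lambda_beta)
  have sing: "{i} \<in> \<Delta>" for i
    using assms unfolding abstract_simplicial_complex_def by blast
  have var: "sr_var \<Delta> i = Some (\<lambda>j. if j = i then 1 else 0)" for i
    using sing[of i] by (auto simp: sr_var_def sr_monomial_def)
  have mult: "\<phi> (a \<otimes>\<^bsub>sr_binoid \<Delta>\<^esub> b) = \<phi> a * \<phi> b"
    if "a \<in> carrier (sr_binoid \<Delta>)" "b \<in> carrier (sr_binoid \<Delta>)" for a b
    using \<phi> that by (auto simp: binoid_hom_def hom_def real_binoid_def)
  have prod: "(\<Prod>i\<in>J. x $ i) = \<phi> (sr_monomial \<Delta> (\<lambda>j. if j \<in> J then 1 else 0))" for J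
  proof -
    have "finite J" by simp
    then show ?thesis
    proof (induction J)
      case empty
      then show ?case
        using \<phi> by (auto simp: sr_monomial_def binoid_hom_def real_binoid_def sr_binoid_def)
    next
      case (insert i J)
      let ?m = "\<lambda>J. sr_monomial \<Delta> (\<lambda>j. if j \<in> J then 1 else 0)"
      have "(\<Prod>i\<in>insert i J. x $ i) = \<phi> (sr_var \<Delta> i) * \<phi> (?m J)"
        using insert x\<phi> by simp
      also have "\<dots> = \<phi> (sr_var \<Delta> i \<otimes>\<^bsub>sr_binoid \<Delta>\<^esub> ?m J)"
        by (rule mult[symmetric]) (auto simp: sr_var_def sr_monomial_def sr_binoid_def)
      also have "sr_var \<Delta> i \<otimes>\<^bsub>sr_binoid \<Delta>\<^esub> ?m J = ?m (insert i J)"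
      proof (cases "J \<in> insert {} \<Delta>")
        case True
        then have m: "?m J = Some (\<lambda>j. if j \<in> J then 1 else 0)"
          by (auto simp: sr_monomial_def)
        have e: "(\<lambda>j. (if j = i then 1 else 0) + (if j \<in> J then 1 else 0 :: nat))
            = (\<lambda>j. if j \<in> insert i J then 1 else 0)"
          using insert by auto
        have "sr_var \<Delta> i \<otimes>\<^bsub>sr_binoid \<Delta>\<^esub> ?m J
            = sr_monomial \<Delta> (\<lambda>j. (if j = i then 1 else 0) + (if j \<in> J then 1 else 0))"
          unfolding var m by (simp only: sr_binoid_def monoid.simps case_prod_conv option.case)
        then show ?thesis
          unfolding e .
      next
        case False
        have "insert i J \<notin> \<Delta>"
        proof
          assume "insert i J \<in> \<Delta>"
          moreover have "J \<noteq> {}" "J \<subseteq> insert i J"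
            using False by auto
          ultimately have "J \<in> \<Delta>"
            using assms unfolding abstract_simplicial_complex_def by metis
          with False show False by simp
        qed
        moreover have "{j. (if j \<in> insert i J then 1 else 0 :: nat) \<noteq> 0} = insert i J"
          by auto
        ultimately have "?m (insert i J) = None"
          unfolding sr_monomial_def by (simp only: insert_iff insert_not_empty if_False simp_thms)
        moreover have "?m J = None"
          using False by (auto simp add: sr_monomial_def)
        ultimately show ?thesis
          unfolding var by (simp add: sr_binoid_def)
      qed
      finally show ?case .
    qed
  qed
  have "sr_monomial \<Delta> (\<lambda>j. if j \<in> I then 1 else 0) = None"
    using I by (auto simp add: sr_monomial_def)
  then show "(\<Prod>i\<in>I. x $ i) = 0"
    using \<phi> prod[of I] by (auto simp: binoid_hom_def real_binoid_def sr_binoid_def)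
next
  fix x :: "real ^ 'n"
  assume "x \<in> {x. \<forall>I. I \<noteq> {} \<and> I \<notin> \<Delta> \<longrightarrow> (\<Prod>i\<in>I. x $ i) = 0}"
  then have x: "(\<Prod>i\<in>I. x $ i) = 0" if "I \<noteq> {}" "I \<notin> \<Delta>" for I
    using that by blast
  have sing: "{i} \<in> \<Delta>" for i
    using assms unfolding abstract_simplicial_complex_def by blast
  define \<phi> where "\<phi> = (\<lambda>a :: ('n \<Rightarrow> nat) option.
    case a of None \<Rightarrow> 0 | Some r \<Rightarrow> \<Prod>i\<in>UNIV. (x $ i) ^ r i)"
  have mon: "\<phi> (sr_monomial \<Delta> r) = (\<Prod>i\<in>UNIV. (x $ i) ^ r i)" for r
  proof (cases "{i. r i \<noteq> 0} \<in> insert {} \<Delta>")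
    case False
    then have "(\<Prod>i\<in>{i. r i \<noteq> 0}. x $ i) = 0"
      by (intro x) auto
    then obtain i where "r i \<noteq> 0" "x $ i = 0"
      by auto
    then have "(\<Prod>i\<in>UNIV. (x $ i) ^ r i) = 0"
      by (auto intro!: exI[of _ i])
    with False show ?thesis by (simp add: \<phi>_def sr_monomial_def)
  qed (auto simp: \<phi>_def sr_monomial_def)
  have "\<phi> \<in> binoid_hom (sr_binoid \<Delta>) real_binoid"
    by (auto simp: binoid_hom_def hom_def real_binoid_def sr_binoid_def mon
        simp: \<phi>_def power_add prod.distrib mon[unfolded \<phi>_def])
  moreover have "\<phi> (sr_var \<Delta> i) = x $ i" for i
  proof -
    have "\<phi> (sr_var \<Delta> i) = (\<Prod>j\<in>UNIV. if j = i then x $ j else 1)"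
      unfolding sr_var_def mon by (intro prod.cong) auto
    then show ?thesis by simp
  qed
  ultimately show "x \<in> real_spectrum \<Delta>"
    unfolding real_spectrum_def by (auto intro!: image_eqI[of _ _ \<phi>] simp: vec_eq_iff)
qed

end

theory Submission
  imports Defs
begin

text \<open>
  The stars \<open>{x | s x\<^sub>i > 0}\<close> of the signed vertices form an open cover of the punctured spectrum by
  contractible sets.  Assign to every point \<open>x\<close> a signed facet \<open>c x\<close> whose closed cone contains \<open>x\<close>.
  For two points of the star of \<open>(i, s)\<close> the generator \<open>\<alpha>\<^sub>i\<close> from \<open>c x\<close> to \<open>c y\<close> is defined; by (R2) it
  does not depend on the star and by (R1) it is multiplicative.  Sampling a path finely and
  multiplying these generators hence gives a functor on the fundamental groupoid.  Conversely,
  \<open>\<alpha>\<^sub>i\<close> is realized by a path through the vertex \<open>(i, s)\<close>, which lies in a single star, so that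
  simple connectedness of the stars gives (R1) and (R2).  One composite is the identity, and the
  segments from the canonical point of \<open>c x\<close> to \<open>x\<close> make the other one naturally isomorphic to it.
\<close>

section \<open>Fundamental groupoids and presented groupoids\<close>

text \<open>The assignment \<open>c\<close> is in general discontinuous at points that lie in
  several cones. This does no harm: only transitions between two points of a common star enter, and
  both refining a sample and moving it across a homotopy change its word by triangles whose corners
  share a star. The index chosen for a transition need not be that of the star containing such a
  triangle, and only (R2) allows exchanging it. In the other direction, a chain with fixed index
  never changes the sign at that index. For (R2) the two chains run in different stars, so a third
  path through the intersection of the stars has to connect them. One composite is strictly the
  identity because the canonical point of a signed facet lies in no other signed cone of a facet. A
  general point \<open>x\<close> differs from the canonical point of \<open>c x\<close>, so the
  other composite moves objects and has to be compared by a natural transformation.\<close>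

definition path_class :: "'a::topological_space set \<Rightarrow> (real \<Rightarrow> 'a) \<Rightarrow> (real \<Rightarrow> 'a) set" where
  "path_class S p = {q. homotopic_paths S p q}"

definition path_in :: "'a::topological_space set \<Rightarrow> 'a \<Rightarrow> (real \<Rightarrow> 'a) \<Rightarrow> 'a \<Rightarrow> bool" where
  "path_in S x p y \<longleftrightarrow> path p \<and> path_image p \<subseteq> S \<and> pathstart p = x \<and> pathfinish p = y"

lemma path_in_D:
  assumes "path_in S x p y"
  shows "path p" "path_image p \<subseteq> S" "pathstart p = x" "pathfinish p = y" "x \<in> S" "y \<in> S"
  using assms unfolding path_in_def by auto

lemma path_in_subset: "path_in S x p y \<Longrightarrow> S \<subseteq> T \<Longrightarrow> path_in T x p y"
  by (auto simp: path_in_def)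

lemma path_in_join: "path_in S x p y \<Longrightarrow> path_in S y q z \<Longrightarrow> path_in S x (p +++ q) z"
  unfolding path_in_def by (simp add: subset_path_image_join)

lemma path_in_reversepath: "path_in S x p y \<Longrightarrow> path_in S y (reversepath p) x"
  unfolding path_in_def by simp

lemma path_in_const: "x \<in> S \<Longrightarrow> path_in S x (\<lambda>_. x) x"
  unfolding path_in_def by (auto simp: path_def path_image_def pathstart_def pathfinish_def)

lemma path_in_homotopic: "path_in S x p y \<Longrightarrow> homotopic_paths S p q \<Longrightarrow> path_in S x q y"
  unfolding path_in_def
  by (metis homotopic_paths_imp_path homotopic_paths_imp_pathfinish
      homotopic_paths_imp_pathstart homotopic_paths_imp_subset)

lemma path_in_refl: "path_in S x p y \<Longrightarrow> homotopic_paths S p p"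
  unfolding path_in_def by simp

lemma path_in_homotopic_join:
  assumes "path_in S x p y" "path_in S y q z" "homotopic_paths S p p'" "homotopic_paths S q q'"
  shows "homotopic_paths S (p +++ q) (p' +++ q')"
  using assms by (intro homotopic_paths_join) (auto simp: path_in_def)

lemma path_in_assoc:
  assumes "path_in S w p x" "path_in S x q y" "path_in S y r z"
  shows "homotopic_paths S (p +++ (q +++ r)) ((p +++ q) +++ r)"
  using assms by (intro homotopic_paths_assoc) (auto simp: path_in_def)

text \<open>Identity morphisms are classes of constant functions, while the unit and inverse laws
  for paths are formulated with degenerate segments; this equation translates between the
  two.\<close>

lemma linepath_refl_eq: "linepath x x = (\<lambda>_. x)"
  by (auto simp: linepath_def algebra_simps simp flip: scaleR_add_left)

lemma path_in_lid:
  fixes S :: "'a::real_normed_vector set"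
  shows "path_in S x p y \<Longrightarrow> homotopic_paths S ((\<lambda>_. x) +++ p) p"
  using homotopic_paths_lid'[of p S x] unfolding path_in_def linepath_refl_eq by auto

lemma path_in_rid:
  fixes S :: "'a::real_normed_vector set"
  shows "path_in S x p y \<Longrightarrow> homotopic_paths S (p +++ (\<lambda>_. y)) p"
  using homotopic_paths_rid'[of p S y] unfolding path_in_def linepath_refl_eq by auto

lemma path_in_rinv:
  fixes S :: "'a::real_normed_vector set"
  shows "path_in S x p y \<Longrightarrow> homotopic_paths S (p +++ reversepath p) (\<lambda>_. x)"
  using homotopic_paths_rinv[of p S] unfolding path_in_def linepath_refl_eq by auto

lemma path_in_linv:
  fixes S :: "'a::real_normed_vector set"
  shows "path_in S x p y \<Longrightarrow> homotopic_paths S (reversepath p +++ p) (\<lambda>_. y)"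
  using homotopic_paths_linv[of p S] unfolding path_in_def linepath_refl_eq by auto

lemma path_class_eqI: "homotopic_paths S p q \<Longrightarrow> path_class S p = path_class S q"
  unfolding path_class_def using homotopic_paths_sym homotopic_paths_trans by blast

lemma fundamental_groupoid_simps [simp]:
  "Obj (fundamental_groupoid S) = S"
  "Hom (fundamental_groupoid S) x y = {path_class S p | p. path_in S x p y}"
  "Ident (fundamental_groupoid S) x = path_class S (\<lambda>_. x)"
  by (simp_all add: fundamental_groupoid_def path_class_def path_in_def)

lemma Comp_fundamental_groupoid:
  assumes "path_in S x p y" "path_in S y q z"
  shows "Comp (fundamental_groupoid S) x y z (path_class S q) (path_class S p)
    = path_class S (p +++ q)"
proof -
  have "homotopic_paths S (p +++ q) r"
    if "homotopic_paths S p p'" "homotopic_paths S q q'" "homotopic_paths S (p' +++ q') r" for p' q' r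
    using path_in_homotopic_join[OF assms that(1,2)] that(3) homotopic_paths_trans by blast
  moreover have "homotopic_paths S p p" "homotopic_paths S q q"
    using assms path_in_refl by blast+
  ultimately show ?thesis
    unfolding fundamental_groupoid_def path_class_def by (simp del: homotopic_paths_refl) blast
qed

lemma groupoid_fundamental_groupoid:
  fixes S :: "'a::real_normed_vector set"
  shows "groupoid (fundamental_groupoid S)"
proof unfold_locales
  fix x y f assume *: "x \<in> Obj (fundamental_groupoid S)" "y \<in> Obj (fundamental_groupoid S)"
    "f \<in> Hom (fundamental_groupoid S) x y"
  then obtain p where p: "path_in S x p y" "f = path_class S p"
    by auto
  note r = path_in_reversepath[OF p(1)]
  show "isomorphism_in (fundamental_groupoid S) x y f"
    unfolding isomorphism_in_def
  proof (intro conjI bexI)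
    show "path_class S (reversepath p) \<in> Hom (fundamental_groupoid S) y x"
      using r by auto
  qed (use * p r in \<open>auto simp: Comp_fundamental_groupoid intro!: path_class_eqI path_in_rinv path_in_linv\<close>)
next
  fix w x y z f g h
  assume "f \<in> Hom (fundamental_groupoid S) w x" "g \<in> Hom (fundamental_groupoid S) x y"
    "h \<in> Hom (fundamental_groupoid S) y z"
  then obtain p q r where p: "path_in S w p x" "f = path_class S p"
    and q: "path_in S x q y" "g = path_class S q" and r: "path_in S y r z" "h = path_class S r"
    by auto
  show "Comp (fundamental_groupoid S) w y z h (Comp (fundamental_groupoid S) w x y g f)
      = Comp (fundamental_groupoid S) w x z (Comp (fundamental_groupoid S) x y z h g) f"
    unfolding p(2) q(2) r(2) Comp_fundamental_groupoid[OF p(1) q(1)] Comp_fundamental_groupoid[OF q(1) r(1)]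
      Comp_fundamental_groupoid[OF path_in_join[OF p(1) q(1)] r(1)]
      Comp_fundamental_groupoid[OF p(1) path_in_join[OF q(1) r(1)]]
    by (rule path_class_eqI[OF path_in_assoc[OF p(1) q(1) r(1)], symmetric])
next
  fix x y f assume *: "x \<in> Obj (fundamental_groupoid S)" "y \<in> Obj (fundamental_groupoid S)"
    "f \<in> Hom (fundamental_groupoid S) x y"
  then obtain p where p: "path_in S x p y" "f = path_class S p" by auto
  note c = path_in_const[OF path_in_D(5)[OF p(1)]] path_in_const[OF path_in_D(6)[OF p(1)]]
  show "Comp (fundamental_groupoid S) x y y (Ident (fundamental_groupoid S) y) f = f"
    "Comp (fundamental_groupoid S) x x y f (Ident (fundamental_groupoid S) x) = f"
    unfolding p(2) fundamental_groupoid_simps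
      Comp_fundamental_groupoid[OF c(1) p(1)] Comp_fundamental_groupoid[OF p(1) c(2)]
    using path_class_eqI[OF path_in_rid[OF p(1)]] path_class_eqI[OF path_in_lid[OF p(1)]] by auto
qed (auto simp: Comp_fundamental_groupoid intro: path_in_const path_in_join)

section \<open>Words, their inverses, and the groupoid that they present\<close>

lemma walk_in:
  assumes "walk X E s t x w y"
  shows "x \<in> X" "y \<in> X"
  using assms by (induction rule: walk.induct) auto

lemma walk_append: "walk X E s t x u y \<Longrightarrow> walk X E s t y v z \<Longrightarrow> walk X E s t x (u @ v) z"
  by (induction rule: walk.induct) (auto intro: walk.intros)

lemma word_eq_walks:
  assumes "word_eq X E s t R x y u v"
  shows "walk X E s t x u y \<and> walk X E s t x v y"
  using assms
proof (induction rule: word_eq.induct)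
  case (word_append x y u u' z v v')
  then show ?case
    using walk_append[of X E s t x u y v z] walk_append[of X E s t x u' y v' z] by blast
qed (simp_all add: walk.intros)

lemmas word_eq_walk = word_eq_walks[THEN conjunct1] word_eq_walks[THEN conjunct2]

definition word_class where
  "word_class X E s t R x y u = {v. word_eq X E s t R x y u v}"

lemma word_class_eqI:
  "word_eq X E s t R x y u v \<Longrightarrow> word_class X E s t R x y u = word_class X E s t R x y v"
  unfolding word_class_def by (intro Collect_cong iffI) (erule word_trans[OF word_sym] word_trans, assumption)+

lemma presented_groupoid_simps [simp]:
  "Obj (presented_groupoid X E s t R) = X"
  "Hom (presented_groupoid X E s t R) x y = {word_class X E s t R x y u | u. walk X E s t x u y}"
  "Ident (presented_groupoid X E s t R) x = word_class X E s t R x x []"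
  by (simp_all add: presented_groupoid_def word_class_def)

lemma Comp_presented_groupoid:
  assumes "walk X E s t x u y" "walk X E s t y v z"
  shows "Comp (presented_groupoid X E s t R) x y z (word_class X E s t R y z v) (word_class X E s t R x y u)
    = word_class X E s t R x z (u @ v)"
proof -
  have "word_eq X E s t R x z (u @ v) w"
    if "word_eq X E s t R x y u u'" "word_eq X E s t R y z v v'" "word_eq X E s t R x z (u' @ v') w" for u' v' w
    using word_trans[OF word_append[OF that(1,2)] that(3)] .
  moreover have "word_eq X E s t R x y u u" "word_eq X E s t R y z v v"
    using assms by (simp_all add: word_refl)
  ultimately show ?thesis
    unfolding presented_groupoid_def word_class_def by simp blast
qed

fun inverse_letter :: "'e letter \<Rightarrow> 'e letter" where
  "inverse_letter (Gen e) = Inv e"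
| "inverse_letter (Inv e) = Gen e"

definition inverse_word :: "'e letter list \<Rightarrow> 'e letter list" where
  "inverse_word w = rev (map inverse_letter w)"

lemma inverse_letter_inverse [simp]: "inverse_letter (inverse_letter l) = l"
  by (cases l) auto

lemma inverse_word_inverse [simp]: "inverse_word (inverse_word w) = w"
  by (simp add: inverse_word_def rev_map o_def)

lemma walk_inverse_word: "walk X E s t x w y \<Longrightarrow> walk X E s t y (inverse_word w) x"
proof (induction rule: walk.induct)
  case (walk_Nil x)
  then show ?case by (simp add: inverse_word_def walk.intros)
next
  case (walk_Gen e w y)
  then have "walk X E s t (t e) [Inv e] (s e)"
    using walk_in by (intro walk.intros) auto
  from walk_append[OF walk_Gen(4) this] show ?case
    by (simp add: inverse_word_def)
next
  case (walk_Inv e w y)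
  then have "walk X E s t (s e) [Gen e] (t e)"
    using walk_in by (intro walk.intros) auto
  from walk_append[OF walk_Inv(4) this] show ?case
    by (simp add: inverse_word_def)
qed

lemma word_eq_insert:
  assumes "word_eq X E s t R y y m []" "walk X E s t x u y" "walk X E s t y v z"
  shows "word_eq X E s t R x z (u @ m @ v) (u @ v)"
  using word_append[OF word_refl[OF assms(2)] word_append[OF assms(1) word_refl[OF assms(3)]]]
  by simp

lemma word_eq_right_inverse:
  "walk X E s t x w y \<Longrightarrow> word_eq X E s t R x x (w @ inverse_word w) []"
proof (induction rule: walk.induct)
  case (walk_Nil x)
  then show ?case by (simp add: inverse_word_def word_refl walk.intros)
next
  case (walk_Gen e w y)
  have te: "t e \<in> X" using walk_in(1)[OF walk_Gen(3)] .
  \<comment> \<open>The inner loop is collapsed first, by the induction hypothesis; the outer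
    letters \<open>Gen e\<close> and \<open>Inv e\<close> then become adjacent.\<close>
  have "word_eq X E s t R (s e) (s e) ([Gen e] @ (w @ inverse_word w) @ [Inv e]) ([Gen e] @ [Inv e])"
    using walk_Gen te by (intro word_eq_insert[OF walk_Gen(4)]) (auto intro: walk.intros)
  moreover have "word_eq X E s t R (s e) (s e) ([Gen e] @ [Inv e]) []"
    using walk_Gen te by (auto intro: word_Gen_Inv)
  ultimately show ?case
    by (simp add: inverse_word_def) (rule word_trans)
next
  case (walk_Inv e w y)
  have te: "s e \<in> X" using walk_in(1)[OF walk_Inv(3)] .
  have "word_eq X E s t R (t e) (t e) ([Inv e] @ (w @ inverse_word w) @ [Gen e]) ([Inv e] @ [Gen e])"
    using walk_Inv te by (intro word_eq_insert[OF walk_Inv(4)]) (auto intro: walk.intros)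
  moreover have "word_eq X E s t R (t e) (t e) ([Inv e] @ [Gen e]) []"
    using walk_Inv te by (auto intro: word_Inv_Gen)
  ultimately show ?case
    by (simp add: inverse_word_def) (rule word_trans)
qed

lemma word_eq_left_inverse:
  "walk X E s t x w y \<Longrightarrow> word_eq X E s t R y y (inverse_word w @ w) []"
  using word_eq_right_inverse[OF walk_inverse_word] by fastforce

text \<open>Cancel one factor \<open>u\<close> with its inverse. Applied to \<open>step x x\<close>,
  this derives the normalization of a cocycle from its multiplicativity alone.\<close>

lemma word_eq_idempotent:
  assumes "word_eq X E s t R x x (u @ u) u"
  shows "word_eq X E s t R x x u []"
proof -
  have u: "walk X E s t x u x" using word_eq_walk(2)[OF assms] .
  note i = walk_inverse_word[OF u]
  have "word_eq X E s t R x x (u @ inverse_word u) ((u @ u) @ inverse_word u)"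
    using word_append[OF word_sym[OF assms] word_refl[OF i]] .
  moreover have "word_eq X E s t R x x (u @ (u @ inverse_word u) @ []) (u @ [])"
    using u walk_in(1)[OF u] by (intro word_eq_insert word_eq_right_inverse) (auto intro: walk_Nil)
  ultimately have "word_eq X E s t R x x (u @ inverse_word u) u"
    by simp (rule word_trans)
  then show ?thesis
    using word_eq_right_inverse[OF u] word_sym word_trans by fast
qed

lemma groupoid_presented_groupoid: "groupoid (presented_groupoid X E s t R)"
proof unfold_locales
  fix x y f assume *: "x \<in> Obj (presented_groupoid X E s t R)" "y \<in> Obj (presented_groupoid X E s t R)"
    "f \<in> Hom (presented_groupoid X E s t R) x y"
  then obtain u where u: "walk X E s t x u y" "f = word_class X E s t R x y u"
    by auto
  note r = walk_inverse_word[OF u(1)]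
  show "isomorphism_in (presented_groupoid X E s t R) x y f"
    unfolding isomorphism_in_def
  proof (intro conjI bexI)
    show "word_class X E s t R y x (inverse_word u) \<in> Hom (presented_groupoid X E s t R) y x"
      using r by auto
  qed (use * u r in \<open>auto simp: Comp_presented_groupoid
      intro!: word_class_eqI word_eq_right_inverse word_eq_left_inverse\<close>)
next
  fix w x y z f g h
  let ?C = "presented_groupoid X E s t R"
  assume "f \<in> Hom ?C w x" "g \<in> Hom ?C x y" "h \<in> Hom ?C y z"
  then obtain p q r where p: "walk X E s t w p x" "f = word_class X E s t R w x p"
    and q: "walk X E s t x q y" "g = word_class X E s t R x y q"
    and r: "walk X E s t y r z" "h = word_class X E s t R y z r"
    by auto
  show "Comp ?C w y z h (Comp ?C w x y g f) = Comp ?C w x z (Comp ?C x y z h g) f"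
    unfolding p(2) q(2) r(2) Comp_presented_groupoid[OF p(1) q(1)] Comp_presented_groupoid[OF q(1) r(1)]
      Comp_presented_groupoid[OF walk_append[OF p(1) q(1)] r(1)]
      Comp_presented_groupoid[OF p(1) walk_append[OF q(1) r(1)]]
    by simp
next
  fix x y z f g
  let ?C = "presented_groupoid X E s t R"
  assume "f \<in> Hom ?C x y" "g \<in> Hom ?C y z"
  then obtain p q where p: "walk X E s t x p y" "f = word_class X E s t R x y p"
    and q: "walk X E s t y q z" "g = word_class X E s t R y z q"
    by auto
  show "Comp ?C x y z g f \<in> Hom ?C x z"
    unfolding p(2) q(2) Comp_presented_groupoid[OF p(1) q(1)] using walk_append[OF p(1) q(1)] by auto
qed (auto simp: Comp_presented_groupoid walk_Nil intro: walk_Nil)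

text \<open>Functor data are total functions, so a functor that fixes all objects and morphisms may
  still differ from \<open>id_functor\<close> outside the category. Identity morphisms serve as
  components of the isomorphism.\<close>

lemma naturally_isomorphic_id_functor:
  assumes "category C" "\<And>x. x \<in> Obj C \<Longrightarrow> fst H x = x"
    and "\<And>x y f. x \<in> Obj C \<Longrightarrow> y \<in> Obj C \<Longrightarrow> f \<in> Hom C x y \<Longrightarrow> snd H x y f = f"
  shows "naturally_isomorphic C C H id_functor"
proof -
  interpret category C by fact
  show ?thesis
    unfolding naturally_isomorphic_def isomorphism_in_def id_functor_def
    by (intro exI[of _ "Ident C"]) (auto simp: assms ident_in ident_left ident_right intro!: bexI[of _ "Ident C _"])
qed

section \<open>Words assigned to paths by a cover\<close>

lemma grid_cell_in_unit:
  assumes "k < n" "r \<in> {real k / real n..real (Suc k) / real n}"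
  shows "r \<in> {0..1}"
proof -
  have "0 \<le> real k / real n" "real (Suc k) / real n \<le> 1"
    using assms(1) by (auto simp: divide_simps)
  with assms(2) show ?thesis by (simp only: atLeastAtMost_iff) argo
qed

text \<open>A cocycle on an open cover with values in a presented groupoid, in the style of Cech:
  \<open>step\<close> is constrained only for points of a common member, and \<open>c\<close> is a
  mere function without continuity. The passage from paths to words depends on nothing else about
  cones and facets.\<close>

locale local_words =
  fixes S :: "'a::topological_space set" and \<U> :: "'a set set"
    and X :: "'o set" and E :: "'e set" and s t :: "'e \<Rightarrow> 'o" and R
    and c :: "'a \<Rightarrow> 'o" and step :: "'a \<Rightarrow> 'a \<Rightarrow> 'e letter list"
  assumes openin_cover: "U \<in> \<U> \<Longrightarrow> openin (top_of_set S) U"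
    and covers: "S \<subseteq> \<Union>\<U>"
    and step_walk: "\<lbrakk>U \<in> \<U>; x \<in> U; y \<in> U\<rbrakk> \<Longrightarrow> walk X E s t (c x) (step x y) (c y)"
    and step_step: "\<lbrakk>U \<in> \<U>; x \<in> U; y \<in> U; z \<in> U\<rbrakk>
      \<Longrightarrow> word_eq X E s t R (c x) (c z) (step x y @ step y z) (step x z)"
begin

abbreviation "wlk \<equiv> walk X E s t"
abbreviation "weq \<equiv> word_eq X E s t R"

definition small :: "'a set \<Rightarrow> bool" where
  "small A \<longleftrightarrow> (\<exists>U\<in>\<U>. A \<subseteq> U)"

lemma small_subset: "small B \<Longrightarrow> A \<subseteq> B \<Longrightarrow> small A"
  unfolding small_def by blast

lemma small_singleton: "x \<in> S \<Longrightarrow> small {x}"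
  using covers unfolding small_def by auto

lemma small_walk: "small {x, y} \<Longrightarrow> wlk (c x) (step x y) (c y)"
  unfolding small_def using step_walk by auto

lemma small_step: "small {x, y, z} \<Longrightarrow> weq (c x) (c z) (step x y @ step y z) (step x z)"
  unfolding small_def using step_step by auto

lemma c_in: "x \<in> S \<Longrightarrow> c x \<in> X"
  using small_singleton[of x] by (intro walk_in(1)[OF small_walk[of x x]]) simp

lemma step_refl: "x \<in> S \<Longrightarrow> weq (c x) (c x) (step x x) []"
  using small_step[of x x x] small_singleton[of x] by (intro word_eq_idempotent) simp

section \<open>Words along finite sequences of points\<close>

primrec sample_word :: "(nat \<Rightarrow> 'a) \<Rightarrow> nat \<Rightarrow> 'e letter list" where
  "sample_word f 0 = []"
| "sample_word f (Suc n) = sample_word f n @ step (f n) (f (Suc n))"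

lemma sample_word_add:
  "sample_word f (m + n) = sample_word f m @ sample_word (\<lambda>k. f (m + k)) n"
  by (induction n) auto

lemma sample_word_cong: "(\<And>k. k \<le> n \<Longrightarrow> f k = g k) \<Longrightarrow> sample_word f n = sample_word g n"
  by (induction n) auto

lemma sample_word_walk:
  assumes "f 0 \<in> S" "\<And>k. k < n \<Longrightarrow> small {f k, f (Suc k)}"
  shows "wlk (c (f 0)) (sample_word f n) (c (f n))"
  using assms(2)
proof (induction n)
  case 0
  then show ?case using c_in[OF assms(1)] by (simp add: walk_Nil)
next
  case (Suc n)
  then show ?case
    using walk_append[of X E s t "c (f 0)" "sample_word f n" "c (f n)"] small_walk[of "f n" "f (Suc n)"]
    by simp
qed

text \<open>Each square of the ladder is cut along the diagonal from \<open>f k\<close> to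
  \<open>g (Suc k)\<close>. Both triangles lie in one member of the cover, so both ways around the
  square equal the diagonal step, and induction pushes the rung from one end to the other.\<close>

lemma sample_word_ladder:
  assumes "small {f 0, g 0}"
    and "\<And>k. k < n \<Longrightarrow> small {f k, f (Suc k), g k, g (Suc k)}"
    and "f 0 \<in> S" "g 0 \<in> S"
  shows "weq (c (f 0)) (c (g n)) (sample_word f n @ step (f n) (g n)) (step (f 0) (g 0) @ sample_word g n)"
  using assms(2)
proof (induction n)
  case 0
  then show ?case using assms(1) by (simp add: word_refl small_walk)
next
  case (Suc n)
  let ?f = "f n" and ?f' = "f (Suc n)" and ?g = "g n" and ?g' = "g (Suc n)"
  have sm: "small {?f, ?f', ?g, ?g'}" using Suc.prems by simp
  have wf: "wlk (c (f 0)) (sample_word f n) (c ?f)"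
  proof (rule sample_word_walk)
    fix k assume "k < n"
    then show "small {f k, f (Suc k)}" by (intro small_subset[OF Suc.prems[of k]]) auto
  qed (use assms in simp)
  have IH: "weq (c (f 0)) (c ?g) (sample_word f n @ step ?f ?g) (step (f 0) (g 0) @ sample_word g n)"
    using Suc by simp
  have "weq (c ?f) (c ?g') (step ?f ?f' @ step ?f' ?g') (step ?f ?g')"
    by (rule small_step, rule small_subset[OF sm]) auto
  moreover have "weq (c ?f) (c ?g') (step ?f ?g @ step ?g ?g') (step ?f ?g')"
    by (rule small_step, rule small_subset[OF sm]) auto
  ultimately have "weq (c ?f) (c ?g') (step ?f ?f' @ step ?f' ?g') (step ?f ?g @ step ?g ?g')"
    using word_trans word_sym by fast
  from word_append[OF word_refl[OF wf] this]
  have 1: "weq (c (f 0)) (c ?g') (sample_word f n @ step ?f ?f' @ step ?f' ?g') (sample_word f n @ step ?f ?g @ step ?g ?g')" .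
  have "wlk (c ?g) (step ?g ?g') (c ?g')"
    by (rule small_walk, rule small_subset[OF sm]) auto
  from word_append[OF IH word_refl[OF this]]
  have 2: "weq (c (f 0)) (c ?g') (sample_word f n @ step ?f ?g @ step ?g ?g')
      (step (f 0) (g 0) @ sample_word g n @ step ?g ?g')" by simp
  from word_trans[OF 1 2] show ?case by simp
qed

text \<open>With common end points the outer rungs are steps from a point to itself, hence
  trivial.\<close>

lemma sample_word_ladder_fixed:
  assumes "\<And>k. k < n \<Longrightarrow> small {f k, f (Suc k), g k, g (Suc k)}"
    and "f 0 = g 0" "f n = g n" "f 0 \<in> S" "f n \<in> S"
  shows "weq (c (f 0)) (c (f n)) (sample_word f n) (sample_word g n)"
proof -
  have f: "wlk (c (f 0)) (sample_word f n) (c (f n))"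
  proof (rule sample_word_walk)
    fix k assume "k < n"
    then show "small {f k, f (Suc k)}" by (intro small_subset[OF assms(1)[of k]]) auto
  qed (use assms in simp)
  have g: "wlk (c (f 0)) (sample_word g n) (c (f n))"
    unfolding assms(2,3)
  proof (rule sample_word_walk)
    fix k assume "k < n"
    then show "small {g k, g (Suc k)}" by (intro small_subset[OF assms(1)[of k]]) auto
  qed (use assms in simp)
  have "weq (c (f 0)) (c (f n)) (sample_word f n @ step (f n) (f n)) (step (f 0) (f 0) @ sample_word g n)"
    using sample_word_ladder[of f g n] assms small_singleton[of "f 0"] by simp
  moreover have "weq (c (f 0)) (c (f n)) (sample_word f n @ step (f n) (f n)) (sample_word f n)"
    using word_append[OF word_refl[OF f] step_refl[OF assms(5)]] by simp
  moreover have "weq (c (f 0)) (c (f n)) (step (f 0) (f 0) @ sample_word g n) (sample_word g n)"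
    using word_append[OF step_refl[OF assms(4)] word_refl[OF g]] by simp
  ultimately show ?thesis
    by (meson word_sym word_trans)
qed

lemma sample_word_small:
  assumes "small (f ` {..n})" "f 0 \<in> S"
  shows "weq (c (f 0)) (c (f n)) (sample_word f n) (step (f 0) (f n))"
  using assms(1)
proof (induction n)
  case 0
  show ?case using word_sym[OF step_refl[OF assms(2)]] by simp
next
  case (Suc n)
  have "weq (c (f 0)) (c (f n)) (sample_word f n) (step (f 0) (f n))"
    by (rule Suc.IH, rule small_subset[OF Suc.prems]) auto
  moreover have "weq (c (f n)) (c (f (Suc n))) (step (f n) (f (Suc n))) (step (f n) (f (Suc n)))"
    by (rule word_refl, rule small_walk, rule small_subset[OF Suc.prems]) auto
  ultimately have "weq (c (f 0)) (c (f (Suc n))) (sample_word f (Suc n)) (step (f 0) (f n) @ step (f n) (f (Suc n)))"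
    by (simp add: word_append)
  moreover have "weq (c (f 0)) (c (f (Suc n))) (step (f 0) (f n) @ step (f n) (f (Suc n))) (step (f 0) (f (Suc n)))"
    by (rule small_step, rule small_subset[OF Suc.prems]) auto
  ultimately show ?case by (rule word_trans)
qed

text \<open>Every block of \<open>m\<close> consecutive steps stays in one member of the cover and
  telescopes to a single step.\<close>

lemma sample_word_refine:
  assumes "\<And>k. k < n \<Longrightarrow> small (f ` {k * m..Suc k * m})" "f 0 \<in> S" "\<And>k. k \<le> n \<Longrightarrow> f (k * m) \<in> S"
  shows "weq (c (f 0)) (c (f (n * m))) (sample_word f (n * m)) (sample_word (\<lambda>k. f (k * m)) n)"
  using assms(1,3)
proof (induction n)
  case 0
  then show ?case using c_in[OF assms(2)] by (simp add: word_refl walk_Nil)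
next
  case (Suc n)
  let ?g = "\<lambda>k. f (n * m + k)"
  have "weq (c (f 0)) (c (f (n * m))) (sample_word f (n * m)) (sample_word (\<lambda>k. f (k * m)) n)"
    using Suc by simp
  moreover have "weq (c (?g 0)) (c (?g m)) (sample_word ?g m) (step (?g 0) (?g m))"
  proof (rule sample_word_small)
    show "small (?g ` {..m})"
      by (rule small_subset[OF Suc.prems(1)[of n]]) auto
    show "?g 0 \<in> S" using Suc.prems(2)[of n] by simp
  qed
  ultimately have "weq (c (f 0)) (c (f (n * m + m))) (sample_word f (n * m) @ sample_word ?g m)
      (sample_word (\<lambda>k. f (k * m)) n @ step (f (n * m)) (f (n * m + m)))"
    using word_append[of X E s t R "c (f 0)" "c (f (n * m))"] by simp
  then show ?case
    using sample_word_add[of f "n * m" m] by (simp add: add.commute[of m])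
qed

section \<open>Subdivisions that are fine enough for the cover, found by compactness\<close>

definition subdiv :: "(real \<Rightarrow> 'a) \<Rightarrow> nat \<Rightarrow> bool" where
  "subdiv p n \<longleftrightarrow> n > 0 \<and> (\<forall>k<n. small (p ` {real k / real n..real (Suc k) / real n}))"

text \<open>The Lebesgue number lemma for the square: the cover is pulled back along
  \<open>H\<close>, and the preimages, which are open only relative to the square, are extended to
  open sets of the plane.\<close>

lemma ex_subdiv_grid:
  fixes H :: "real \<times> real \<Rightarrow> 'a"
  assumes cont: "continuous_on ({0..1} \<times> {0..1}) H" and im: "H ` ({0..1} \<times> {0..1}) \<subseteq> S"
  obtains n :: nat where "n > 0"
    "\<And>j k. j < n \<Longrightarrow> k < n \<Longrightarrow>
      small (H ` ({real j / real n..real (Suc j) / real n} \<times> {real k / real n..real (Suc k) / real n}))"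
proof -
  let ?Q = "{0..1} \<times> {0..1} :: (real \<times> real) set"
  define \<C> where "\<C> = {T. open T \<and> small (H ` (T \<inter> ?Q))}"
  have "?Q \<subseteq> \<Union>\<C>"
  proof
    fix z assume z: "z \<in> ?Q"
    then obtain U where U: "U \<in> \<U>" "H z \<in> U" using im covers by blast
    have "openin (top_of_set ?Q) (?Q \<inter> H -` U)"
      using continuous_openin_preimage[OF cont] im openin_cover[OF U(1)] by blast
    then obtain T where T: "open T" "?Q \<inter> H -` U = ?Q \<inter> T" unfolding openin_open by blast
    have "z \<in> T" using T(2) U(2) z by blast
    moreover have "H ` (T \<inter> ?Q) \<subseteq> U" using T(2) by blast
    ultimately show "z \<in> \<Union>\<C>" using T(1) U(1) unfolding \<C>_def small_def by blast
  qed
  moreover have "compact ?Q" by (intro compact_Times compact_Icc)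
  ultimately obtain e where e: "e > 0" "\<And>z. z \<in> ?Q \<Longrightarrow> \<exists>G\<in>\<C>. ball z e \<subseteq> G"
    using Heine_Borel_lemma[of ?Q \<C>] unfolding \<C>_def by blast
  \<comment> \<open>A point of a cell of side \<open>1 / n\<close> is within \<open>2 / n\<close> of
    its lower left corner, since the norm of a pair is at most the sum of the norms.\<close>
  obtain n :: nat where n: "n > 0" "2 / real n < e"
  proof -
    obtain n :: nat where "2 / e < real n" using reals_Archimedean2 by blast
    then have "2 / e < real (Suc n)" by simp
    then have "2 / real (Suc n) < e" using e(1) by (simp add: field_simps)
    then show thesis using that[of "Suc n"] by blast
  qed
  show thesis
  proof (rule that[OF n(1)])
    fix j k assume jk: "j < n" "k < n"
    let ?z = "(real j / real n, real k / real n)"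
    let ?B = "{real j / real n..real (Suc j) / real n} \<times> {real k / real n..real (Suc k) / real n}"
    have "?z \<in> ?Q" using jk by (simp add: divide_simps)
    then obtain G where G: "G \<in> \<C>" "ball ?z e \<subseteq> G" using e(2) by blast
    have "?B \<subseteq> ball ?z e"
    proof
      fix w assume w: "w \<in> ?B"
      obtain a b where ab: "w = (a, b)" by force
      have "\<bar>real j / real n - a\<bar> \<le> 1 / real n" "\<bar>real k / real n - b\<bar> \<le> 1 / real n"
        using w n(1) unfolding ab by (auto simp: add_divide_distrib)
      then have "dist ?z w \<le> 2 / real n"
        using norm_Pair_le[of "real j / real n - a" "real k / real n - b"]
        unfolding ab dist_norm by simp
      then show "w \<in> ball ?z e" using n(2) by simp
    qed
    moreover have "?B \<subseteq> ?Q"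
      using grid_cell_in_unit[OF jk(1)] grid_cell_in_unit[OF jk(2)] by (intro Sigma_mono subsetI)
    ultimately have "?B \<subseteq> G \<inter> ?Q" using G(2) by blast
    then show "small (H ` ?B)" using G(1) unfolding \<C>_def by (blast intro: small_subset)
  qed
qed

text \<open>A path is treated as a map on the square that ignores the first coordinate; the row
  \<open>j = 0\<close> of the grid then gives the subdivision.\<close>

lemma ex_subdiv:
  assumes "path p" "path_image p \<subseteq> S"
  shows "\<exists>n. subdiv p n"
proof -
  have "continuous_on ({0..1} \<times> {0..1}) (p \<circ> snd :: real \<times> real \<Rightarrow> 'a)"
    using assms(1) unfolding path_def
    by (intro continuous_on_compose continuous_intros) (auto elim: continuous_on_subset)
  moreover have "(p \<circ> snd) ` ({0..1} \<times> {0..1} :: (real \<times> real) set) \<subseteq> S"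
    using assms(2) unfolding path_image_def by auto
  ultimately obtain n where n: "n > 0" "\<And>j k. j < n \<Longrightarrow> k < n \<Longrightarrow>
      small ((p \<circ> snd) ` ({real j / real n..real (Suc j) / real n} \<times> {real k / real n..real (Suc k) / real n}))"
    by (rule ex_subdiv_grid) blast
  have "subdiv p n"
    unfolding subdiv_def
  proof (intro conjI allI impI n(1))
    fix k assume "k < n"
    have "(real 0 / real n) \<le> real (Suc 0) / real n" by simp
    then show "small (p ` {real k / real n..real (Suc k) / real n})"
      by (intro small_subset[OF n(2)[OF n(1) \<open>k < n\<close>]]) (force simp: image_iff)
  qed
  then show ?thesis by blast
qed

text \<open>Since \<open>subdiv\<close> speaks of whole cells rather than of their end points, it
  passes to finer grids: cell \<open>k\<close> of the finer grid lies in cell \<open>k div m\<close>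
  of the coarser one.\<close>

lemma subdiv_mult:
  assumes "subdiv p n" "m > 0"
  shows "subdiv p (n * m)"
  unfolding subdiv_def
proof (intro conjI allI impI)
  show "n * m > 0" using assms unfolding subdiv_def by simp
  fix k assume k: "k < n * m"
  let ?j = "k div m"
  have j: "?j < n" using k by (simp add: less_mult_imp_div_less)
  have n: "n > 0" using assms unfolding subdiv_def by simp
  have "?j * m \<le> k" "Suc k \<le> Suc ?j * m"
    using assms(2) by (simp_all add: Suc_le_eq dividend_less_div_times)
  then have "real ?j * real m \<le> real k" "real (Suc k) \<le> real (Suc ?j) * real m"
    by (simp_all only: flip: of_nat_mult of_nat_le_iff)
  then have "real ?j / real n \<le> real k / real (n * m)" "real (Suc k) / real (n * m) \<le> real (Suc ?j) / real n"
    using assms(2) n by (simp_all add: divide_simps mult.commute del: of_nat_Suc)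
  then show "small (p ` {real k / real (n * m)..real (Suc k) / real (n * m)})"
    using assms(1) j unfolding subdiv_def by (force intro: small_subset)
qed

section \<open>Words of paths and their invariance under homotopy\<close>

definition path_word :: "(real \<Rightarrow> 'a) \<Rightarrow> nat \<Rightarrow> 'e letter list" where
  "path_word p n = sample_word (\<lambda>k. p (real k / real n)) n"

lemma subdiv_small:
  assumes "subdiv p n" "k < n"
  shows "small {p (real k / real n), p (real (Suc k) / real n)}"
proof -
  let ?a = "real k / real n" and ?b = "real (Suc k) / real n"
  have "?a \<le> ?b" by (simp add: divide_right_mono)
  then have "{p ?a, p ?b} \<subseteq> p ` {?a..?b}"
    by (simp del: of_nat_Suc)
  moreover have "small (p ` {?a..?b})"
    using assms unfolding subdiv_def by blast
  ultimately show ?thesis by (rule small_subset[rotated])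
qed

lemma path_in_grid: "path_in S x p y \<Longrightarrow> k \<le> n \<Longrightarrow> p (real k / real n) \<in> S"
  unfolding path_in_def path_image_def by (cases "n = 0") (auto simp: divide_simps)

lemma path_word_walk:
  assumes "path_in S x p y" "subdiv p n"
  shows "wlk (c x) (path_word p n) (c y)"
proof -
  have "n > 0" "p 0 = x" "p 1 = y" "x \<in> S"
    using assms path_in_D(5)[OF assms(1)] unfolding subdiv_def path_in_def pathstart_def pathfinish_def by auto
  moreover have "wlk (c (p (real 0 / real n))) (path_word p n) (c (p (real n / real n)))"
    unfolding path_word_def
  proof (rule sample_word_walk)
    show "p (real 0 / real n) \<in> S" using calculation by simp
  qed (rule subdiv_small[OF assms(2)])
  ultimately show ?thesis by simp
qed

lemma path_word_refine:
  assumes "path_in S x p y" "subdiv p n" "m > 0"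
  shows "weq (c x) (c y) (path_word p (n * m)) (path_word p n)"
proof -
  let ?f = "\<lambda>k. p (real k / real (n * m))"
  have n: "n > 0" using assms(2) unfolding subdiv_def by simp
  have p: "p 0 = x" "p 1 = y" "x \<in> S"
    using assms path_in_D(5)[OF assms(1)] unfolding path_in_def pathstart_def pathfinish_def by auto
  \<comment> \<open>At the indices \<open>k * m\<close> the fine samples are the coarse ones, and
    the samples between two of them stay in the image of one coarse cell.\<close>
  have "weq (c (?f 0)) (c (?f (n * m))) (sample_word ?f (n * m)) (sample_word (\<lambda>k. ?f (k * m)) n)"
  proof (rule sample_word_refine)
    fix k assume k: "k < n"
    have "?f l \<in> p ` {real k / real n..real (Suc k) / real n}" if "l \<in> {k * m..Suc k * m}" for l
    proof (rule imageI)
      have "real k * real m \<le> real l" "real l \<le> real (Suc k) * real m"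
        using that by (simp_all only: atLeastAtMost_iff of_nat_le_iff flip: of_nat_mult)
      then have "real k \<le> real l / real m" "real l / real m \<le> real (Suc k)"
        using assms(3) by (simp_all only: pos_le_divide_eq pos_divide_le_eq of_nat_0_less_iff)
      then have "real k / real n \<le> real l / real m / real n" "real l / real m / real n \<le> real (Suc k) / real n"
        by (simp_all only: divide_right_mono of_nat_0_le_iff)
      moreover have "real l / real m / real n = real l / real (n * m)"
        by (simp add: mult.commute)
      ultimately show "real l / real (n * m) \<in> {real k / real n..real (Suc k) / real n}"
        by (simp only: atLeastAtMost_iff)
    qed
    then have "?f ` {k * m..Suc k * m} \<subseteq> p ` {real k / real n..real (Suc k) / real n}"
      by (intro image_subsetI)
    moreover have "small (p ` {real k / real n..real (Suc k) / real n})"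
      using assms(2) k unfolding subdiv_def by blast
    ultimately show "small (?f ` {k * m..Suc k * m})"
      by (rule small_subset[rotated])
  next
    fix k assume "k \<le> n"
    then show "?f (k * m) \<in> S" by (intro path_in_grid[OF assms(1)]) simp
  qed (simp add: p)
  then show ?thesis
    using n assms(3) p unfolding path_word_def by simp
qed

text \<open>The grid with \<open>n * m\<close> cells refines both.\<close>

lemma path_word_unique:
  assumes "path_in S x p y" "subdiv p n" "subdiv p m"
  shows "weq (c x) (c y) (path_word p n) (path_word p m)"
proof -
  have "n > 0" "m > 0" using assms unfolding subdiv_def by auto
  then have "weq (c x) (c y) (path_word p (n * m)) (path_word p n)"
    "weq (c x) (c y) (path_word p (n * m)) (path_word p m)"
    using path_word_refine[OF assms(1,2), of m] path_word_refine[OF assms(1,3), of n]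
    by (simp_all add: mult.commute)
  then show ?thesis using word_sym word_trans by fast
qed

text \<open>The samples of the homotopy along the rows of a fine grid give words. Consecutive rows
  form a ladder whose end points agree because the homotopy fixes them; the rows \<open>0\<close>
  and \<open>N\<close> sample \<open>p\<close> and \<open>q\<close>.\<close>

lemma path_word_homotopic:
  assumes "path_in S x p y" "homotopic_paths S p q" "subdiv p n" "subdiv q m"
  shows "weq (c x) (c y) (path_word p n) (path_word q m)"
proof -
  have q: "path_in S x q y" using path_in_homotopic assms by blast
  have px: "pathstart p = x" "pathfinish p = y" "x \<in> S" "y \<in> S" using path_in_D[OF assms(1)] by auto
  obtain H where "continuous_on ({0..1} \<times> {0..1}) H" "H \<in> {0..1} \<times> {0..1} \<rightarrow> S"
    "\<forall>r\<in>{0..1}. H (0, r) = p r" "\<forall>r\<in>{0..1}. H (1, r) = q r"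
    "\<forall>r\<in>{0..1::real}. pathstart (H \<circ> Pair r) = pathstart p \<and> pathfinish (H \<circ> Pair r) = pathfinish p"
    using assms(2) unfolding homotopic_paths by blast
  then have H: "continuous_on ({0..1} \<times> {0..1}) H" "H ` ({0..1} \<times> {0..1}) \<subseteq> S"
    "\<And>r. r \<in> {0..1} \<Longrightarrow> H (0, r) = p r" "\<And>r. r \<in> {0..1} \<Longrightarrow> H (1, r) = q r"
    "\<And>r. r \<in> {0..1} \<Longrightarrow> H (r, 0) = x" "\<And>r. r \<in> {0..1} \<Longrightarrow> H (r, 1) = y"
    using px by (auto simp: pathstart_def pathfinish_def)
  obtain N where N: "N > 0" "\<And>j k. j < N \<Longrightarrow> k < N \<Longrightarrow>
      small (H ` ({real j / real N..real (Suc j) / real N} \<times> {real k / real N..real (Suc k) / real N}))"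
    using ex_subdiv_grid[OF H(1,2)] by blast
  define f where "f j k = H (real j / real N, real k / real N)" for j k
  have le: "real k / real N \<le> real (Suc k) / real N" for k by (simp add: divide_right_mono)
  have in01: "real k / real N \<in> {0..1}" if "k \<le> N" for k using that N(1) by (simp add: divide_simps)
  have ends: "f j 0 = x" "f j N = y" if "j \<le> N" for j
    using in01[OF that] H(5,6) N(1) unfolding f_def by auto
  have row: "weq (c x) (c y) (sample_word (f 0) N) (sample_word (f j) N)" if "j \<le> N" for j
    using that
  proof (induction j)
    case 0
    have "wlk (c (f 0 0)) (sample_word (f 0) N) (c (f 0 N))"
    proof (rule sample_word_walk)
      fix k assume k: "k < N"
      show "small {f 0 k, f 0 (Suc k)}"
        unfolding f_def using le by (intro small_subset[OF N(2)[OF N(1) k]]) (auto simp del: of_nat_Suc)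
    qed (use ends px in auto)
    then show ?case using ends by (simp add: word_refl)
  next
    case (Suc j)
    have "weq (c (f j 0)) (c (f j N)) (sample_word (f j) N) (sample_word (f (Suc j)) N)"
    proof (rule sample_word_ladder_fixed)
      fix k assume k: "k < N"
      show "small {f j k, f j (Suc k), f (Suc j) k, f (Suc j) (Suc k)}"
        unfolding f_def using le Suc.prems
        by (intro small_subset[OF N(2)[of j, OF _ k]]) (auto simp del: of_nat_Suc)
    qed (use ends px Suc.prems in auto)
    with ends Suc.prems have "weq (c x) (c y) (sample_word (f j) N) (sample_word (f (Suc j)) N)" by simp
    then show ?case using Suc by (intro word_trans[OF Suc.IH]) simp_all
  qed
  have p0: "sample_word (f 0) N = path_word p N"
    unfolding path_word_def f_def using in01 H(3) by (intro sample_word_cong) auto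
  have q0: "sample_word (f N) N = path_word q N"
    unfolding path_word_def f_def using in01 H(4) N(1) by (intro sample_word_cong) auto
  \<comment> \<open>The edge of the square with first coordinate 0 lies in the first row of cells,
    so the same \<open>N\<close> subdivides \<open>p\<close>.\<close>
  have "subdiv p N"
    unfolding subdiv_def
  proof (intro conjI allI impI N(1))
    fix k assume k: "k < N"
    have "p ` {real k / real N..real (Suc k) / real N} \<subseteq>
      H ` ({real 0 / real N..real (Suc 0) / real N} \<times> {real k / real N..real (Suc k) / real N})"
    proof
      fix v assume "v \<in> p ` {real k / real N..real (Suc k) / real N}"
      then obtain r where r: "v = p r" "r \<in> {real k / real N..real (Suc k) / real N}" by blast
      then have r01: "r \<in> {0..1}" using grid_cell_in_unit[OF k] by blast
      show "v \<in> H ` ({real 0 / real N..real (Suc 0) / real N} \<times> {real k / real N..real (Suc k) / real N})"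
      proof (rule image_eqI[of _ _ "(0, r)"])
        show "v = H (0, r)" using H(3)[OF r01] r(1) by simp
        have "0 \<in> {real 0 / real N..real (Suc 0) / real N}" by simp
        with r(2) show "(0, r) \<in> {real 0 / real N..real (Suc 0) / real N} \<times> {real k / real N..real (Suc k) / real N}"
          by (rule SigmaI[rotated])
      qed
    qed
    then show "small (p ` {real k / real N..real (Suc k) / real N})"
      using N(2)[OF N(1) k] small_subset by blast
  qed
  moreover have "subdiv q N"
    unfolding subdiv_def
  proof (intro conjI allI impI N(1))
    fix k assume k: "k < N"
    \<comment> \<open>The opposite edge lies in the last row of cells, which has number
      \<open>N - 1\<close> and ends at the parameter 1.\<close>
    have N1: "N - 1 < N" "real (Suc (N - 1)) / real N = 1" "real (N - 1) / real N \<le> 1"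
      using N(1) by (auto simp: divide_simps)
    have "q ` {real k / real N..real (Suc k) / real N} \<subseteq>
      H ` ({real (N - 1) / real N..real (Suc (N - 1)) / real N} \<times> {real k / real N..real (Suc k) / real N})"
    proof
      fix v assume "v \<in> q ` {real k / real N..real (Suc k) / real N}"
      then obtain r where r: "v = q r" "r \<in> {real k / real N..real (Suc k) / real N}" by blast
      then have r01: "r \<in> {0..1}" using grid_cell_in_unit[OF k] by blast
      show "v \<in> H ` ({real (N - 1) / real N..real (Suc (N - 1)) / real N} \<times> {real k / real N..real (Suc k) / real N})"
      proof (rule image_eqI[of _ _ "(1, r)"])
        show "v = H (1, r)" using H(4)[OF r01] r(1) by simp
        have "1 \<in> {real (N - 1) / real N..real (Suc (N - 1)) / real N}"
          unfolding atLeastAtMost_iff N1(2) using N1(3) by simp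
        with r(2) show "(1, r) \<in> {real (N - 1) / real N..real (Suc (N - 1)) / real N} \<times> {real k / real N..real (Suc k) / real N}"
          by (rule SigmaI[rotated])
      qed
    qed
    then show "small (q ` {real k / real N..real (Suc k) / real N})"
      using N(2)[OF N1(1) k] small_subset by blast
  qed
  ultimately show ?thesis
    using word_trans[OF path_word_unique[OF assms(1,3)]
        word_trans[OF row[of N, unfolded p0 q0] path_word_unique[OF q _ assms(4)]]] by simp
qed

text \<open>With equally many cells on both halves the midpoint is a grid point, and each cell of
  the joined path is a cell of \<open>p\<close> or \<open>q\<close> scaled by one half. Hence the
  words are equal and not merely equivalent.\<close>

lemma path_word_join:
  assumes "path_in S x p y" "path_in S y q z" "subdiv p n" "subdiv q n"
  shows "subdiv (p +++ q) (n + n)" "path_word (p +++ q) (n + n) = path_word p n @ path_word q n"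
proof -
  have n: "n > 0" using assms(3) unfolding subdiv_def by simp
  have yy: "p 1 = y" "q 0 = y" using assms(1,2) unfolding path_in_def pathfinish_def pathstart_def by auto
  have first: "(p +++ q) r = p (2 * r)" if "r \<le> 1/2" for r
    using that by (simp add: joinpaths_def)
  have second: "(p +++ q) r = q (2 * r - 1)" if "r \<ge> 1/2" for r
  \<comment> \<open>At the midpoint \<open>joinpaths\<close> evaluates \<open>p\<close>, so the
    common point \<open>y\<close> of the two paths enters.\<close>
  proof (cases "r = 1/2")
    case True
    show ?thesis unfolding True using yy by (simp add: joinpaths_def)
  qed (use that in \<open>simp add: joinpaths_def\<close>)
  have half: "real k / real (n + n) = real k / real n / 2" for k by simp
  have half': "real (n + k) / real (n + n) = 1 / 2 + real k / real n / 2" for k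
    using n unfolding half by (simp add: add_divide_distrib)
  show "subdiv (p +++ q) (n + n)"
    unfolding subdiv_def
  proof (intro conjI allI impI)
    fix k assume k: "k < n + n"
    show "small ((p +++ q) ` {real k / real (n + n)..real (Suc k) / real (n + n)})"
    proof (cases "k < n")
      case True
      have "(p +++ q) ` {real k / real (n + n)..real (Suc k) / real (n + n)} \<subseteq> p ` {real k / real n..real (Suc k) / real n}"
      proof (intro image_subsetI)
        fix r assume r: "r \<in> {real k / real (n + n)..real (Suc k) / real (n + n)}"
        have "real (Suc k) / real n \<le> 1" using True n by (simp add: divide_simps)
        then have "r \<le> 1 / 2" "2 * r \<in> {real k / real n..real (Suc k) / real n}"
          using r unfolding half by (simp_all del: of_nat_Suc)
        moreover from this have "(p +++ q) r = p (2 * r)" by (intro first)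
        ultimately show "(p +++ q) r \<in> p ` {real k / real n..real (Suc k) / real n}" by simp
      qed
      then show ?thesis using assms(3) True unfolding subdiv_def using small_subset by blast
    next
      case False
      define j where "j = k - n"
      have kj: "k = n + j" using False j_def by simp
      have j: "j < n" using k kj by simp
      have "(p +++ q) ` {real k / real (n + n)..real (Suc k) / real (n + n)} \<subseteq> q ` {real j / real n..real (Suc j) / real n}"
      proof (intro image_subsetI)
        fix r assume r: "r \<in> {real k / real (n + n)..real (Suc k) / real (n + n)}"
        have "0 \<le> real j / real n" by simp
        moreover have "1 / 2 + real j / real n / 2 \<le> r" "r \<le> 1 / 2 + real (Suc j) / real n / 2"
          using r unfolding kj half' half'[of "Suc j", simplified add_Suc_right] by (simp_all del: of_nat_Suc)
        ultimately have "r \<ge> 1 / 2" "2 * r - 1 \<in> {real j / real n..real (Suc j) / real n}"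
          unfolding atLeastAtMost_iff by argo+
        moreover from this have "(p +++ q) r = q (2 * r - 1)" by (intro second)
        ultimately show "(p +++ q) r \<in> q ` {real j / real n..real (Suc j) / real n}" by simp
      qed
      then show ?thesis using assms(4) j unfolding subdiv_def using small_subset by blast
    qed
  qed (use n in simp)
  have "(p +++ q) (real k / real (n + n)) = p (real k / real n)" if "k \<le> n" for k
  proof -
    have "real k / real n \<le> 1" using that n by (simp add: divide_simps)
    then show ?thesis unfolding half by (subst first) simp_all
  qed
  moreover have "(p +++ q) (real (n + k) / real (n + n)) = q (real k / real n)" for k
    unfolding half' by (subst second) simp_all
  ultimately show "path_word (p +++ q) (n + n) = path_word p n @ path_word q n"
    unfolding path_word_def sample_word_add by (intro arg_cong2[of _ _ _ _ append] sample_word_cong)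
qed

lemma subdiv_small_image: "U \<in> \<U> \<Longrightarrow> path_image p \<subseteq> U \<Longrightarrow> subdiv p 1"
  unfolding subdiv_def small_def path_image_def by auto

lemma path_word_1: "path_word p 1 = step (p 0) (p 1)"
  unfolding path_word_def by simp

section \<open>The functor from the fundamental groupoid to words\<close>

definition word_functor where
  "word_functor = (c, \<lambda>x y f. {w. \<exists>p\<in>f. \<exists>n. subdiv p n \<and> weq (c x) (c y) (path_word p n) w})"

text \<open>\<open>word_functor\<close> collects the words of all representatives on all fine grids,
  so nothing is chosen; homotopy invariance shows that the collection is a single class.\<close>

lemma word_functor_class:
  assumes "path_in S x p y" "subdiv p n"
  shows "snd word_functor x y (path_class S p) = word_class X E s t R (c x) (c y) (path_word p n)"
proof -
  have "weq (c x) (c y) (path_word p n) w"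
    if "homotopic_paths S p q" "subdiv q m" "weq (c x) (c y) (path_word q m) w" for q m w
    using word_trans[OF path_word_homotopic[OF assms(1) that(1) assms(2) that(2)] that(3)] .
  moreover have "homotopic_paths S p p" using path_in_refl assms(1) by blast
  ultimately show ?thesis
    using assms(2) unfolding word_functor_def path_class_def word_class_def snd_conv by blast
qed

lemma is_functor_word_functor:
  "is_functor (fundamental_groupoid S) (presented_groupoid X E s t R) word_functor"
proof -
  have subdiv_ex: "\<exists>n. subdiv p n" if "path_in S x p y" for x p y
    using that ex_subdiv unfolding path_in_def by blast
  have o: "fst word_functor = c" by (simp add: word_functor_def)
  have "snd word_functor x y f \<in> Hom (presented_groupoid X E s t R) (c x) (c y)"
    if "f \<in> Hom (fundamental_groupoid S) x y" for x y f
  proof -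
    from that obtain p where p: "path_in S x p y" "f = path_class S p" by auto
    obtain n where n: "subdiv p n" using subdiv_ex[OF p(1)] by blast
    show ?thesis
      unfolding p(2) word_functor_class[OF p(1) n] using path_word_walk[OF p(1) n] by auto
  qed
  moreover have "snd word_functor x x (path_class S (\<lambda>_. x)) = word_class X E s t R (c x) (c x) []"
    if "x \<in> S" for x
  proof -
    note k = path_in_const[OF that]
    obtain U where "U \<in> \<U>" "x \<in> U" using covers \<open>x \<in> S\<close> by blast
    then have "subdiv (\<lambda>_. x) 1" by (intro subdiv_small_image[of U]) (auto simp: path_image_def)
    from word_functor_class[OF k this] show ?thesis
      unfolding path_word_1 using word_class_eqI[OF step_refl[OF that]] by simp
  qed
  moreover have "snd word_functor x z (Comp (fundamental_groupoid S) x y z g f)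
      = Comp (presented_groupoid X E s t R) (c x) (c y) (c z) (snd word_functor y z g) (snd word_functor x y f)"
    if "f \<in> Hom (fundamental_groupoid S) x y" "g \<in> Hom (fundamental_groupoid S) y z" for x y z f g
  proof -
    from that(1) obtain p where p: "path_in S x p y" "f = path_class S p" by auto
    from that(2) obtain q where q: "path_in S y q z" "g = path_class S q" by auto
    obtain n m where "subdiv p n" "subdiv q m" using subdiv_ex[OF p(1)] subdiv_ex[OF q(1)] by blast
    \<comment> \<open>Both paths are brought to a common number of cells, as the formula for joined
      paths requires.\<close>
    then have f: "subdiv p (n * m)" "subdiv q (n * m)"
      using subdiv_mult[of p n m] subdiv_mult[of q m n] by (auto simp: subdiv_def mult.commute)
    note j = path_word_join[OF p(1) q(1) f]
    show ?thesis
      unfolding p(2) q(2) word_functor_class[OF p(1) f(1)] word_functor_class[OF q(1) f(2)]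
        Comp_fundamental_groupoid[OF p(1) q(1)] word_functor_class[OF path_in_join[OF p(1) q(1)] j(1)] j(2)
      by (rule Comp_presented_groupoid[symmetric]; intro path_word_walk p q f)
  qed
  ultimately show ?thesis
    unfolding is_functor_def o using c_in by (simp del: fundamental_groupoid_simps(2) presented_groupoid_simps(2))
qed

end

section \<open>Signed cones and open stars\<close>

definition sign_value :: "sign_symbol \<Rightarrow> real" where
  "sign_value s = (case s of Plus_sign \<Rightarrow> 1 | Minus_sign \<Rightarrow> -1)"

lemma sign_value_simps [simp]:
  "sign_value Plus_sign = 1" "sign_value Minus_sign = -1" "sign_value s * sign_value s = 1" "sign_value s \<noteq> 0"
  by (cases s; simp add: sign_value_def)+

lemma sign_value_unique:
  assumes "0 < sign_value s * r" "0 < sign_value t * r"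
  shows "s = t"
  using assms by (cases s; cases t) auto

lemma ex_sign: "r \<noteq> 0 \<Longrightarrow> \<exists>s. 0 < sign_value s * r"
  by (cases "0 < r") (auto intro: exI[of _ Plus_sign] exI[of _ Minus_sign])

text \<open>A closed orthant of the coordinate space of a facet, without its origin. Vanishing
  coordinates impose no sign, so neighbouring orthants overlap in their common boundary.\<close>

definition signed_cone :: "'n::finite signed_facet \<Rightarrow> (real ^ 'n) set" where
  "signed_cone a = {x. x \<noteq> 0 \<and> (\<forall>i. x $ i \<noteq> 0 \<longrightarrow> i \<in> fst a \<and> 0 < sign_value (snd a i) * x $ i)}"

definition signed_vertex :: "'n::finite \<Rightarrow> sign_symbol \<Rightarrow> real ^ 'n" where
  "signed_vertex i s = axis i (sign_value s)"

definition facet_point :: "'n::finite signed_facet \<Rightarrow> real ^ 'n" where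
  "facet_point a = (\<chi> i. if i \<in> fst a then sign_value (snd a i) else 0)"

text \<open>A nonzero coordinate of a point shows its sign in every cone containing the point. This
  makes all facets chosen inside a star agree at the index of the star.\<close>

lemma signed_cone_coord:
  assumes "x \<in> signed_cone a" "0 < sign_value s * x $ i"
  shows "i \<in> fst a" "snd a i = s"
proof -
  have "x $ i \<noteq> 0" using assms(2) by auto
  then have "i \<in> fst a \<and> 0 < sign_value (snd a i) * x $ i"
    using assms(1) unfolding signed_cone_def by blast
  with sign_value_unique assms(2) show "i \<in> fst a" "snd a i = s" by blast+
qed

lemma signed_cone_nonneg: "x \<in> signed_cone a \<Longrightarrow> 0 \<le> sign_value (snd a i) * x $ i"
  unfolding signed_cone_def by (cases "x $ i = 0") auto

text \<open>Weak inequalities are enough, because they become strict at a nonzero coordinate; the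
  single positive coordinate excludes the origin.\<close>

lemma signed_coneI:
  assumes "0 < sign_value s * x $ j" "\<And>i. x $ i \<noteq> 0 \<Longrightarrow> i \<in> fst a \<and> 0 \<le> sign_value (snd a i) * x $ i"
  shows "x \<in> signed_cone a"
proof -
  have "0 < sign_value (snd a i) * x $ i" if "x $ i \<noteq> 0" for i
    using assms(2)[OF that] that by (simp add: order_less_le)
  moreover have "x \<noteq> 0" using assms(1) by auto
  ultimately show ?thesis using assms(2) unfolding signed_cone_def by auto
qed

text \<open>The orthant stays convex without its origin because coordinates of equal sign cannot
  cancel in a convex combination: a nonzero coordinate of a point with positive weight
  survives.\<close>

lemma convex_signed_cone:
  fixes a :: "'n::finite signed_facet"
  shows "convex (signed_cone a)"
proof (rule convexI)
  fix x y :: "real ^ 'n" and u v :: real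
  assume x: "x \<in> signed_cone a" and y: "y \<in> signed_cone a" and uv: "0 \<le> u" "0 \<le> v" "u + v = 1"
  let ?z = "u *\<^sub>R x + v *\<^sub>R y"
  have z: "sign_value s * ?z $ i = u * (sign_value s * x $ i) + v * (sign_value s * y $ i)" for i s
    by (simp add: algebra_simps)
  obtain j where "0 < sign_value (snd a j) * ?z $ j"
  proof (cases "u = 0")
    case True
    obtain j where "y $ j \<noteq> 0" using y unfolding signed_cone_def by (auto simp: vec_eq_iff)
    then have "0 < sign_value (snd a j) * y $ j" using y unfolding signed_cone_def by auto
    with that[of j] True uv show thesis by simp
  next
    case False
    obtain j where "x $ j \<noteq> 0" using x unfolding signed_cone_def by (auto simp: vec_eq_iff)
    then have "0 < u * (sign_value (snd a j) * x $ j)" using x False uv unfolding signed_cone_def by auto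
    moreover have "0 \<le> v * (sign_value (snd a j) * y $ j)"
      using uv(2) signed_cone_nonneg[OF y] by (rule mult_nonneg_nonneg)
    ultimately show thesis using that[of j] unfolding z by linarith
  qed
  then show "?z \<in> signed_cone a"
  proof (rule signed_coneI)
    fix i assume "?z $ i \<noteq> 0"
    then have "x $ i \<noteq> 0 \<or> y $ i \<noteq> 0" by auto
    then have "i \<in> fst a" using x y unfolding signed_cone_def by auto
    moreover have "0 \<le> sign_value (snd a i) * ?z $ i"
      unfolding z using mult_nonneg_nonneg[OF uv(1) signed_cone_nonneg[OF x]]
        mult_nonneg_nonneg[OF uv(2) signed_cone_nonneg[OF y]] by (rule add_nonneg_nonneg)
    ultimately show "i \<in> fst a \<and> 0 \<le> sign_value (snd a i) * ?z $ i" ..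
  qed
qed

locale simplicial_complex =
  fixes \<Delta> :: "'n::finite set set"
  assumes complex: "abstract_simplicial_complex UNIV \<Delta>"
begin

abbreviation "X \<equiv> real_punctured_spectrum \<Delta>"
abbreviation "SF \<equiv> signed_facets \<Delta>"
abbreviation "FG \<equiv> facet_gens \<Delta>"
abbreviation "FR \<equiv> facet_rel1 \<Delta> \<union> facet_rel2 \<Delta>"
abbreviation "fwalk \<equiv> walk SF FG gen_source gen_target"
abbreviation "fweq \<equiv> word_eq SF FG gen_source gen_target FR"

lemma face_subset: "F \<in> \<Delta> \<Longrightarrow> G \<noteq> {} \<Longrightarrow> G \<subseteq> F \<Longrightarrow> G \<in> \<Delta>"
  using complex unfolding abstract_simplicial_complex_def by blast

lemma face_nonempty: "F \<in> \<Delta> \<Longrightarrow> F \<noteq> {}"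
  using complex unfolding abstract_simplicial_complex_def by blast

text \<open>The product over \<open>I\<close> is nonzero exactly if \<open>I\<close> lies in the
  support. The equations therefore say that the support, if nonempty, is a face, and removing the
  closed point makes it nonempty.\<close>

lemma punctured_spectrum_iff: "x \<in> X \<longleftrightarrow> {i. x $ i \<noteq> 0} \<in> \<Delta>"
proof
  assume "x \<in> X"
  then have x: "x \<in> real_spectrum \<Delta>" "{i. x $ i \<noteq> 0} \<noteq> {}"
    unfolding real_punctured_spectrum_def by auto
  have "(\<Prod>i\<in>I. x $ i) = 0" if "I \<noteq> {}" "I \<notin> \<Delta>" for I
    using x(1) that unfolding real_spectrum_eq[OF complex] by simp
  from this[OF x(2)] show "{i. x $ i \<noteq> 0} \<in> \<Delta>" by auto
next
  assume s: "{i. x $ i \<noteq> 0} \<in> \<Delta>"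
  have "(\<Prod>i\<in>I. x $ i) = 0" if I: "I \<noteq> {}" "I \<notin> \<Delta>" for I
  proof -
    have "\<not> I \<subseteq> {i. x $ i \<noteq> 0}" using face_subset[OF s I(1)] I(2) by blast
    then obtain i where "i \<in> I" "x $ i = 0" by blast
    then show ?thesis by (intro prod_zero) auto
  qed
  then have "x \<in> real_spectrum \<Delta>" unfolding real_spectrum_eq[OF complex] by simp
  moreover obtain i where "x $ i \<noteq> 0" using face_nonempty[OF s] by blast
  ultimately show "x \<in> X" unfolding real_punctured_spectrum_def by blast
qed

lemma signed_facet_face: "a \<in> SF \<Longrightarrow> fst a \<in> \<Delta>"
  unfolding signed_facets_def facets_def by auto

lemma signed_cone_subset:
  assumes "a \<in> SF"
  shows "signed_cone a \<subseteq> X"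
proof
  fix x assume x: "x \<in> signed_cone a"
  have "{i. x $ i \<noteq> 0} \<noteq> {}" "{i. x $ i \<noteq> 0} \<subseteq> fst a"
    using x unfolding signed_cone_def by (auto simp: vec_eq_iff)
  then show "x \<in> X"
    unfolding punctured_spectrum_iff by (rule face_subset[OF signed_facet_face[OF assms]])
qed

lemma ex_signed_cone:
  assumes "x \<in> X"
  shows "\<exists>a. a \<in> SF \<and> x \<in> signed_cone a"
proof -
  let ?S = "{i. x $ i \<noteq> 0}"
  have S: "?S \<in> \<Delta>" using assms punctured_spectrum_iff by blast
  have "finite \<Delta>" by (rule finite_subset[of _ "Pow UNIV"]) auto
  from finite_has_maximal2[OF this S] obtain F where F: "F \<in> \<Delta>" "?S \<subseteq> F" "\<forall>G\<in>\<Delta>. F \<subseteq> G \<longrightarrow> F = G"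
    by blast
  \<comment> \<open>At indices in \<open>F\<close> where \<open>x\<close> vanishes no sign meets the
    condition, and \<open>SOME\<close> returns an arbitrary one; any sign is admissible
    there.\<close>
  let ?a = "(F, restrict (\<lambda>i. SOME s. 0 < sign_value s * x $ i) F)"
  have "?a \<in> SF" using F unfolding signed_facets_def facets_def by auto
  moreover have "x \<in> signed_cone ?a"
  proof -
    obtain j where "x $ j \<noteq> 0" using face_nonempty[OF S] by blast
    then obtain s where "0 < sign_value s * x $ j" using ex_sign by blast
    then show ?thesis
    proof (rule signed_coneI)
      fix i assume i: "x $ i \<noteq> 0"
      have "i \<in> F" using i F(2) by blast
      then show "i \<in> fst ?a \<and> 0 \<le> sign_value (snd ?a i) * x $ i"
        using someI_ex[OF ex_sign[OF i]] by simp
    qed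
  qed
  ultimately show ?thesis by blast
qed

section \<open>Open stars of the signed vertices\<close>

definition star :: "'n \<Rightarrow> sign_symbol \<Rightarrow> (real ^ 'n) set" where
  "star i s = {x \<in> X. 0 < sign_value s * x $ i}"

lemma star_subset: "star i s \<subseteq> X"
  unfolding star_def by blast

text \<open>The star is starlike about its vertex: moving towards the vertex rescales the
  coordinates other than \<open>i\<close> and keeps the sign at \<open>i\<close>, so the support
  never grows and remains a face.\<close>

lemma simply_connected_star: "simply_connected (star i s)"
proof (rule starlike_imp_simply_connected)
  have "{i} \<in> \<Delta>" using complex unfolding abstract_simplicial_complex_def by blast
  then have v: "signed_vertex i s \<in> star i s"
    unfolding star_def punctured_spectrum_iff signed_vertex_def by (auto simp: axis_def)
  moreover have "closed_segment (signed_vertex i s) x \<subseteq> star i s" if x: "x \<in> star i s" for x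
  proof
    fix z assume "z \<in> closed_segment (signed_vertex i s) x"
    then obtain u where u: "0 \<le> u" "u \<le> 1" and z: "z = (1 - u) *\<^sub>R signed_vertex i s + u *\<^sub>R x"
      unfolding closed_segment_def by blast
    have xi: "0 < sign_value s * x $ i" using x unfolding star_def by blast
    have "sign_value s * z $ i = (1 - u) + u * (sign_value s * x $ i)"
      unfolding z signed_vertex_def by (simp add: axis_def algebra_simps)
    moreover have "0 < (1 - u) + u * (sign_value s * x $ i)"
    proof (cases "u = 0")
      case False
      then show ?thesis using u mult_pos_pos[of u, OF _ xi] by linarith
    qed simp
    ultimately have zi: "0 < sign_value s * z $ i" by simp
    have "{k. z $ k \<noteq> 0} \<subseteq> {k. x $ k \<noteq> 0}"
    proof
      fix k assume "k \<in> {k. z $ k \<noteq> 0}"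
      then show "k \<in> {k. x $ k \<noteq> 0}"
        using xi unfolding z signed_vertex_def by (cases "k = i") (auto simp: axis_def)
    qed
    moreover have "{k. z $ k \<noteq> 0} \<noteq> {}" using zi by (auto intro!: exI[of _ i])
    moreover have "{k. x $ k \<noteq> 0} \<in> \<Delta>" using x unfolding star_def punctured_spectrum_iff by blast
    ultimately have "z \<in> X"
      unfolding punctured_spectrum_iff using face_subset by simp
    with zi show "z \<in> star i s" unfolding star_def by simp
  qed
  ultimately show "starlike (star i s)" unfolding starlike_def by blast
qed

lemma star_homotopic:
  assumes "path_in (star i s) x p y" "path_in (star i s) x q y"
  shows "homotopic_paths X p q"
proof (rule homotopic_paths_subset[OF _ star_subset])
  show "homotopic_paths (star i s) p q"
    using simply_connected_star[of i s] assms
    unfolding simply_connected_eq_homotopic_paths path_in_def by simp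
qed

lemma openin_star: "openin (top_of_set X) (star i s)"
proof -
  have "star i s = X \<inter> {x. 0 < sign_value s * x $ i}" unfolding star_def by blast
  moreover have "open {x :: real ^ 'n. 0 < sign_value s * x $ i}"
    by (intro open_Collect_less continuous_intros)
  ultimately show ?thesis by (simp add: openin_open_Int)
qed

lemma ex_star:
  assumes "x \<in> X"
  shows "\<exists>i s. x \<in> star i s"
proof -
  obtain i where "x $ i \<noteq> 0" using assms face_nonempty unfolding punctured_spectrum_iff by blast
  then show ?thesis using ex_sign assms unfolding star_def by blast
qed

lemma star_coord: "x \<in> signed_cone a \<Longrightarrow> x \<in> star i s \<Longrightarrow> i \<in> fst a \<and> snd a i = s"
  using signed_cone_coord unfolding star_def by blast

text \<open>A star need not be convex, but its part in a single cone is the intersection of that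
  cone with a half-space.\<close>

lemma path_in_star_linepath:
  assumes "a \<in> SF" "x \<in> signed_cone a" "y \<in> signed_cone a" "x \<in> star i s" "y \<in> star i s"
  shows "path_in (star i s) x (linepath x y) y"
proof -
  have "convex {x :: real ^ 'n. 0 < sign_value s * x $ i}"
  proof -
    have "{x :: real ^ 'n. 0 < sign_value s * x $ i} = {x. inner (axis i (sign_value s)) x > 0}"
      by (simp add: inner_axis')
    then show ?thesis using convex_halfspace_gt by simp
  qed
  then have "closed_segment x y \<subseteq> {x. 0 < sign_value s * x $ i}"
    using assms(4,5) unfolding star_def by (intro closed_segment_subset) auto
  moreover have "closed_segment x y \<subseteq> signed_cone a"
    using assms(2,3) by (intro closed_segment_subset convex_signed_cone)
  ultimately show ?thesis
    using signed_cone_subset[OF assms(1)] unfolding path_in_def star_def by auto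
qed

lemma facet_point_in_cone:
  assumes "a \<in> SF"
  shows "facet_point a \<in> signed_cone a"
proof -
  obtain j where "j \<in> fst a" using face_nonempty signed_facet_face[OF assms] by blast
  then have "0 < sign_value (snd a j) * facet_point a $ j" by (simp add: facet_point_def)
  then show ?thesis by (rule signed_coneI) (auto simp: facet_point_def split: if_splits)
qed

lemma facet_point_in_star: "a \<in> SF \<Longrightarrow> i \<in> fst a \<Longrightarrow> facet_point a \<in> star i (snd a i)"
  using subsetD[OF signed_cone_subset facet_point_in_cone]
  unfolding star_def by (simp add: facet_point_def)

text \<open>Any cone containing the point will do. Nearby points may receive different facets, but
  inside a star all of them agree at its index.\<close>

definition carrier_facet :: "real ^ 'n \<Rightarrow> 'n signed_facet" where
  "carrier_facet x = (SOME a. a \<in> SF \<and> x \<in> signed_cone a)"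

lemma carrier_facet:
  assumes "x \<in> X"
  shows "carrier_facet x \<in> SF" "x \<in> signed_cone (carrier_facet x)"
  using someI_ex[OF ex_signed_cone[OF assms]] unfolding carrier_facet_def by auto

lemma carrier_facet_star: "x \<in> star i s \<Longrightarrow> i \<in> fst (carrier_facet x) \<and> snd (carrier_facet x) i = s"
  using star_coord[OF carrier_facet(2)] star_subset[of i s] by blast

lemma carrier_facet_agree: "x \<in> star i s \<Longrightarrow> y \<in> star i s \<Longrightarrow> agree_at i (carrier_facet x) (carrier_facet y)"
  using carrier_facet_star unfolding agree_at_def by simp

text \<open>The point has a nonzero coordinate at every element of its facet, so any cone containing
  it belongs to a facet at least as large, and maximality forces equality. The signs are then read
  off from the coordinates.\<close>

lemma carrier_facet_point:
  assumes "a \<in> SF"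
  shows "carrier_facet (facet_point a) = a"
proof -
  let ?b = "carrier_facet (facet_point a)"
  have b: "?b \<in> SF"
    using carrier_facet(1) facet_point_in_cone signed_cone_subset assms by blast
  have ab: "i \<in> fst ?b \<and> snd ?b i = snd a i" if "i \<in> fst a" for i
    using carrier_facet_star facet_point_in_star[OF assms that] by blast
  then have "fst ?b = fst a"
    using assms signed_facet_face[OF b] unfolding signed_facets_def facets_def by auto
  moreover from this have "snd ?b = snd a"
    using assms b ab unfolding signed_facets_def
    by (intro PiE_ext[of _ "fst a" "\<lambda>_. UNIV"]) auto
  ultimately show ?thesis by (simp add: prod_eq_iff)
qed

section \<open>From paths to words\<close>

text \<open>The index is chosen from the two facets alone and need not be that of a star containing
  \<open>x\<close> and \<open>y\<close>. Without a common index the letter is not a generator; this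
  cannot occur for two points of one star.\<close>

definition facet_step :: "real ^ 'n \<Rightarrow> real ^ 'n \<Rightarrow> 'n facet_gen letter list" where
  "facet_step x y = [Gen (SOME i. agree_at i (carrier_facet x) (carrier_facet y), carrier_facet x, carrier_facet y)]"

lemma fwalk_single:
  assumes "(i, a, b) \<in> FG"
  shows "fwalk a [Gen (i, a, b)] b"
proof -
  have "a \<in> SF" "b \<in> SF" using assms unfolding facet_gens_def by auto
  then show ?thesis
    using walk_Gen[OF assms, where X = SF and s = gen_source and t = gen_target and w = "[]" and y = b]
    by (simp add: walk_Nil)
qed

lemma facet_gensI: "x \<in> star i s \<Longrightarrow> y \<in> star i s \<Longrightarrow> (i, carrier_facet x, carrier_facet y) \<in> FG"
  unfolding facet_gens_def using carrier_facet(1) carrier_facet_agree[of x i s y] star_subset[of i s]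
  by auto

text \<open>A single generator is a chain of length one, so (R2) applies to it.\<close>

lemma facet_gen_change_index:
  assumes "(i, a, b) \<in> FG" "(j, a, b) \<in> FG"
  shows "fweq a b [Gen (i, a, b)] [Gen (j, a, b)]"
proof (rule word_rel)
  have "index_chain \<Delta> k a b [Gen (k, a, b)]" if "(k, a, b) \<in> FG" for k
    unfolding index_chain_def using fwalk_single[OF that] by (auto intro!: exI[of _ "[(k, a, b)]"])
  then show "([Gen (i, a, b)], [Gen (j, a, b)]) \<in> FR"
    using assms unfolding facet_rel2_def facet_gens_def by blast
qed (intro fwalk_single assms)+

lemma facet_step_gen:
  assumes "x \<in> star i s" "y \<in> star i s"
  shows "fweq (carrier_facet x) (carrier_facet y) (facet_step x y) [Gen (i, carrier_facet x, carrier_facet y)]"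
  unfolding facet_step_def
proof (rule facet_gen_change_index)
  show "(SOME i. agree_at i (carrier_facet x) (carrier_facet y), carrier_facet x, carrier_facet y) \<in> FG"
    using someI[of "\<lambda>i. agree_at i (carrier_facet x) (carrier_facet y)", OF carrier_facet_agree[OF assms]]
      facet_gensI[OF assms] unfolding facet_gens_def by simp
qed (rule facet_gensI[OF assms])

lemma facet_rel1I:
  "(i, a, b) \<in> FG \<Longrightarrow> (i, b, d) \<in> FG \<Longrightarrow> (i, a, d) \<in> FG
    \<Longrightarrow> ([Gen (i, a, b), Gen (i, b, d)], [Gen (i, a, d)]) \<in> facet_rel1 \<Delta>"
  unfolding facet_rel1_def by blast

text \<open>The three steps may carry three different chosen indices. (R2) replaces all of them by
  the index of the common star, and for that index (R1) composes.\<close>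

lemma facet_step_step:
  assumes "x \<in> star i s" "y \<in> star i s" "z \<in> star i s"
  shows "fweq (carrier_facet x) (carrier_facet z) (facet_step x y @ facet_step y z) (facet_step x z)"
proof -
  let ?a = "carrier_facet x" and ?b = "carrier_facet y" and ?d = "carrier_facet z"
  have g: "(i, ?a, ?b) \<in> FG" "(i, ?b, ?d) \<in> FG" "(i, ?a, ?d) \<in> FG"
    using assms by (simp_all add: facet_gensI[of _ _ s])
  have "fweq ?a ?d ([Gen (i, ?a, ?b)] @ [Gen (i, ?b, ?d)]) [Gen (i, ?a, ?d)]"
  proof (rule word_rel)
    show "([Gen (i, ?a, ?b)] @ [Gen (i, ?b, ?d)], [Gen (i, ?a, ?d)]) \<in> FR"
      using facet_rel1I[OF g] by simp
  qed (intro walk_append[OF fwalk_single fwalk_single] fwalk_single g)+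
  from word_trans[OF word_append[OF facet_step_gen[OF assms(1,2)] facet_step_gen[OF assms(2,3)]]
      word_trans[OF this word_sym[OF facet_step_gen[OF assms(1,3)]]]]
  show ?thesis .
qed

definition star_cover :: "(real ^ 'n) set set" where
  "star_cover = {star i s | i s. True}"

sublocale local_words X star_cover SF FG gen_source gen_target FR carrier_facet facet_step
proof
  fix U x y z assume "U \<in> star_cover"
  then obtain i s where U: "U = star i s" unfolding star_cover_def by blast
  show "openin (top_of_set X) U" unfolding U by (rule openin_star)
  assume xy: "x \<in> U" "y \<in> U"
  show "fwalk (carrier_facet x) (facet_step x y) (carrier_facet y)"
    using word_eq_walk(1)[OF facet_step_gen] xy unfolding U by blast
  assume "z \<in> U"
  with xy show "fweq (carrier_facet x) (carrier_facet z) (facet_step x y @ facet_step y z) (facet_step x z)"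
    unfolding U by (intro facet_step_step)
next
  show "X \<subseteq> \<Union>star_cover" using ex_star unfolding star_cover_def by blast
qed

section \<open>From words to paths\<close>

text \<open>The direct segment may leave the spectrum, since its interior may be supported on the
  union of two facets. The signed vertex lies in both cones, so each half of the detour stays in one
  cone.\<close>

definition gen_path :: "'n facet_gen \<Rightarrow> real \<Rightarrow> real ^ 'n" where
  "gen_path e = linepath (facet_point (gen_source e)) (signed_vertex (gen_index e) (snd (gen_source e) (gen_index e)))
     +++ linepath (signed_vertex (gen_index e) (snd (gen_source e) (gen_index e))) (facet_point (gen_target e))"

lemma signed_vertex_in_cone:
  assumes "i \<in> fst a"
  shows "signed_vertex i (snd a i) \<in> signed_cone a"
proof -
  have "0 < sign_value (snd a i) * signed_vertex i (snd a i) $ i"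
    by (simp add: signed_vertex_def axis_def)
  then show ?thesis
    by (rule signed_coneI) (use assms in \<open>auto simp: signed_vertex_def axis_def split: if_splits\<close>)
qed

lemma signed_vertex_in_star:
  assumes "a \<in> SF" "i \<in> fst a"
  shows "signed_vertex i (snd a i) \<in> star i (snd a i)"
proof -
  have "signed_vertex i (snd a i) \<in> X"
    using signed_vertex_in_cone[OF assms(2)] signed_cone_subset[OF assms(1)] by blast
  then show ?thesis by (simp add: star_def signed_vertex_def axis_def)
qed

lemma gen_path_in_star:
  assumes "(i, a, b) \<in> FG"
  shows "path_in (star i (snd a i)) (facet_point a) (gen_path (i, a, b)) (facet_point b)"
proof -
  have ab: "a \<in> SF" "b \<in> SF" "i \<in> fst a" "i \<in> fst b" and s: "snd b i = snd a i"
    using assms unfolding facet_gens_def agree_at_def by auto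
  have "path_in (star i (snd a i)) (facet_point a) (linepath (facet_point a) (signed_vertex i (snd a i)))
      (signed_vertex i (snd a i))"
    by (rule path_in_star_linepath[OF ab(1)])
      (intro facet_point_in_cone signed_vertex_in_cone facet_point_in_star signed_vertex_in_star ab)+
  moreover have "path_in (star i (snd b i)) (signed_vertex i (snd b i))
      (linepath (signed_vertex i (snd b i)) (facet_point b)) (facet_point b)"
    by (rule path_in_star_linepath[OF ab(2)])
      (intro facet_point_in_cone signed_vertex_in_cone facet_point_in_star signed_vertex_in_star ab)+
  ultimately show ?thesis
    unfolding s gen_path_def by (simp add: path_in_join)
qed

fun letter_path :: "'n facet_gen letter \<Rightarrow> real \<Rightarrow> real ^ 'n" where
  "letter_path (Gen e) = gen_path e"
| "letter_path (Inv e) = reversepath (gen_path e)"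

fun letter_end :: "'n facet_gen letter \<Rightarrow> 'n signed_facet" where
  "letter_end (Gen e) = gen_target e"
| "letter_end (Inv e) = gen_source e"

text \<open>The parameter \<open>a\<close> is read only at the empty word, where no letter
  determines the base point. On other words the letters fix the path, and \<open>walk\<close>
  guarantees that its pieces fit together.\<close>

primrec word_path :: "'n signed_facet \<Rightarrow> 'n facet_gen letter list \<Rightarrow> real \<Rightarrow> real ^ 'n" where
  "word_path a [] = (\<lambda>_. facet_point a)"
| "word_path a (l # w) = letter_path l +++ word_path (letter_end l) w"

lemma facet_point_in_space: "a \<in> SF \<Longrightarrow> facet_point a \<in> X"
  using subsetD[OF signed_cone_subset facet_point_in_cone] .

lemma gen_path_in:
  assumes "e \<in> FG"
  shows "path_in X (facet_point (gen_source e)) (gen_path e) (facet_point (gen_target e))"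
proof -
  obtain i a b where e: "e = (i, a, b)" using prod_cases3 by blast
  show ?thesis
    using path_in_subset[OF gen_path_in_star star_subset] assms unfolding e by simp
qed

lemma word_path_in: "fwalk a w b \<Longrightarrow> path_in X (facet_point a) (word_path a w) (facet_point b)"
proof (induction rule: walk.induct)
  case (walk_Nil x)
  then show ?case by (simp add: path_in_const facet_point_in_space)
next
  case (walk_Gen e w y)
  then show ?case using path_in_join[OF gen_path_in] by simp
next
  case (walk_Inv e w y)
  then show ?case using path_in_join[OF path_in_reversepath[OF gen_path_in]] by simp
qed

text \<open>Only a homotopy is available, because joining paths is neither strictly associative nor
  strictly unital and the empty word contributes a constant path.\<close>

lemma word_path_append:
  assumes "fwalk a u b" "fwalk b v d"
  shows "homotopic_paths X (word_path a (u @ v)) (word_path a u +++ word_path b v)"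
  using assms
proof (induction rule: walk.induct)
  case (walk_Nil x)
  then show ?case using homotopic_paths_sym[OF path_in_lid[OF word_path_in]] by simp
next
  case (walk_Gen e w y)
  note g = gen_path_in[OF walk_Gen(1)] and w = word_path_in[OF walk_Gen(3)] and v = word_path_in[OF walk_Gen(5)]
  have "homotopic_paths X (gen_path e +++ word_path (gen_target e) (w @ v))
      (gen_path e +++ (word_path (gen_target e) w +++ word_path y v))"
    using walk_append[OF walk_Gen(3,5)] walk_Gen(4)[OF walk_Gen(5)] g
    by (intro path_in_homotopic_join[OF g word_path_in]) (auto simp: path_in_def)
  also have "homotopic_paths X \<dots> ((gen_path e +++ word_path (gen_target e) w) +++ word_path y v)"
    by (rule path_in_assoc[OF g w v])
  finally show ?case by simp
next
  case (walk_Inv e w y)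
  note g = path_in_reversepath[OF gen_path_in[OF walk_Inv(1)]]
    and w = word_path_in[OF walk_Inv(3)] and v = word_path_in[OF walk_Inv(5)]
  have "homotopic_paths X (reversepath (gen_path e) +++ word_path (gen_source e) (w @ v))
      (reversepath (gen_path e) +++ (word_path (gen_source e) w +++ word_path y v))"
    using walk_append[OF walk_Inv(3,5)] walk_Inv(4)[OF walk_Inv(5)] g
    by (intro path_in_homotopic_join[OF g word_path_in]) (auto simp: path_in_def)
  also have "homotopic_paths X \<dots> ((reversepath (gen_path e) +++ word_path (gen_source e) w) +++ word_path y v)"
    by (rule path_in_assoc[OF g w v])
  finally show ?case by simp
qed

lemma fwalk_Cons_Gen:
  assumes "fwalk a (Gen e # w) b"
  shows "e \<in> FG" "gen_source e = a" "fwalk (gen_target e) w b"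
  using assms by (cases rule: walk.cases; simp)+

text \<open>Generators with index \<open>i\<close> preserve the sign at \<open>i\<close>, so the
  points of all intermediate facets lie in the same star.\<close>

lemma chain_path_in_star:
  assumes "fwalk a (map Gen es) b" "\<forall>e\<in>set es. gen_index e = i" "i \<in> fst a" "snd a i = s"
  shows "path_in (star i s) (facet_point a) (word_path a (map Gen es)) (facet_point b)"
  using assms
proof (induction es arbitrary: a)
  case Nil
  then have "a = b" "a \<in> SF" by (auto elim: walk.cases)
  then show ?case using Nil facet_point_in_star[of a i] by (auto intro: path_in_const)
next
  case (Cons e es)
  obtain d where e: "e = (i, a, d)" and d: "fwalk d (map Gen es) b" and g: "(i, a, d) \<in> FG"
    using fwalk_Cons_Gen[of a e "map Gen es" b] Cons.prems by (cases e) auto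
  have "i \<in> fst d" "snd d i = s" using g Cons.prems unfolding facet_gens_def agree_at_def by auto
  then have "path_in (star i s) (facet_point d) (word_path d (map Gen es)) (facet_point b)"
    using Cons.IH[OF d] Cons.prems by simp
  moreover have "path_in (star i s) (facet_point a) (gen_path e) (facet_point d)"
    using gen_path_in_star[OF g] Cons.prems e by simp
  ultimately show ?case using path_in_join e by fastforce
qed

lemma index_chain_path_in_star:
  assumes "index_chain \<Delta> i a b u" "agree_at i a b"
  shows "path_in (star i (snd a i)) (facet_point a) (word_path a u) (facet_point b)"
proof -
  obtain es where "fwalk a u b" "u = map Gen es" "\<forall>e\<in>set es. gen_index e = i"
    using assms(1) unfolding index_chain_def by blast
  moreover have "i \<in> fst a" using assms(2) unfolding agree_at_def by blast
  ultimately show ?thesis using chain_path_in_star[of a es b i] by simp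
qed

text \<open>Both words run in a star of their own index; the point \<open>w\<close> lies in both stars, so that the
  path through \<open>w\<close> links them.\<close>

lemma facet_rel2_homotopic:
  assumes "a \<in> SF" "b \<in> SF" "agree_at i a b" "agree_at j a b"
    and "path_in (star i (snd a i)) (facet_point a) p (facet_point b)"
    and "path_in (star j (snd a j)) (facet_point a) q (facet_point b)"
  shows "homotopic_paths X p q"
proof -
  let ?w = "\<chi> k. if k = i \<or> k = j then sign_value (snd a k) else 0"
  let ?m = "linepath (facet_point a) ?w +++ linepath ?w (facet_point b)"
  have w: "?w \<in> signed_cone d" if d: "agree_at i a d" "agree_at j a d" for d
  proof (rule signed_coneI[of "snd a i" _ i])
    fix k assume "?w $ k \<noteq> 0"
    then have "k = i \<or> k = j" by (auto split: if_splits)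
    then show "k \<in> fst d \<and> 0 \<le> sign_value (snd d k) * ?w $ k"
      using d unfolding agree_at_def by auto
  qed simp
  have aa: "agree_at i a a" "agree_at j a a" using assms unfolding agree_at_def by auto
  have wX: "?w \<in> X" using w[OF aa] signed_cone_subset[OF assms(1)] by blast
  have m: "path_in (star k (snd a k)) (facet_point a) ?m (facet_point b)" if k: "k = i \<or> k = j" for k
  proof (rule path_in_join)
    have ws: "?w \<in> star k (snd a k)" using wX k by (auto simp: star_def)
    have ka: "k \<in> fst a" "k \<in> fst b" "snd b k = snd a k" using assms(3,4) k unfolding agree_at_def by auto
    show "path_in (star k (snd a k)) (facet_point a) (linepath (facet_point a) ?w) ?w"
      by (rule path_in_star_linepath[OF assms(1)])
        (intro facet_point_in_cone facet_point_in_star w aa ws ka assms)+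
    show "path_in (star k (snd a k)) ?w (linepath ?w (facet_point b)) (facet_point b)"
      by (rule path_in_star_linepath[OF assms(2)])
        (use facet_point_in_star[OF assms(2) ka(2)] facet_point_in_cone[OF assms(2)] w assms ws ka in auto)
  qed
  have "homotopic_paths X p ?m" using star_homotopic[OF assms(5)] m by blast
  also have "homotopic_paths X ?m q" using star_homotopic[OF _ assms(6)] m by blast
  finally show ?thesis .
qed

text \<open>Both sides are chains with the same index and hence give paths in one simply connected
  star.\<close>

lemma facet_rel1_homotopic:
  assumes "(u, v) \<in> facet_rel1 \<Delta>" "fwalk a u b"
  shows "homotopic_paths X (word_path a u) (word_path a v)"
proof -
  obtain i a' c d where uv': "u = [Gen (i, a', c), Gen (i, c, d)]" "v = [Gen (i, a', d)]"
    and g': "(i, a', c) \<in> FG" "(i, c, d) \<in> FG" "(i, a', d) \<in> FG"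
    using assms(1) unfolding facet_rel1_def by blast
  have "a' = a"
    using fwalk_Cons_Gen(2)[of a "(i, a', c)" "[Gen (i, c, d)]" b] assms(2) unfolding uv' by simp
  note uv = uv'[unfolded this] and g = g'[unfolded this]
  have d: "fwalk a v d" using fwalk_single[OF g(3)] uv by simp
  moreover have "fwalk a u d"
    using walk_append[OF fwalk_single[OF g(1)] fwalk_single[OF g(2)]] uv by simp
  moreover have "i \<in> fst a" using g unfolding facet_gens_def agree_at_def by auto
  ultimately show ?thesis
    using chain_path_in_star[of a "[(i, a, c), (i, c, d)]" d i] chain_path_in_star[of a "[(i, a, d)]" d i]
    unfolding uv by (intro star_homotopic[of i "snd a i"]) auto
qed

lemma word_path_homotopic:
  assumes "fweq a b u v"
  shows "homotopic_paths X (word_path a u) (word_path a v)"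
  using assms
proof (induction rule: word_eq.induct)
  case (word_rel u v x y)
  from word_rel(1) show ?case
  proof
    assume "(u, v) \<in> facet_rel1 \<Delta>"
    then show ?thesis using facet_rel1_homotopic word_rel by blast
  next
    assume "(u, v) \<in> facet_rel2 \<Delta>"
    then obtain i j a b where ab: "a \<in> SF" "b \<in> SF" "agree_at i a b" "agree_at j a b"
      and c: "index_chain \<Delta> i a b u" "index_chain \<Delta> j a b v"
      unfolding facet_rel2_def by blast
    \<comment> \<open>A chain contains at least one generator, whose source is the start of the
      word.\<close>
    have "x = a"
    proof -
      obtain e es where u: "u = Gen e # map Gen es" "fwalk a u b"
        using c(1) unfolding index_chain_def by (metis list.exhaust list.simps(9))
      with fwalk_Cons_Gen(2) word_rel(2) show ?thesis by metis
    qed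
    then show ?thesis
      using facet_rel2_homotopic[OF ab] index_chain_path_in_star[OF c(1) ab(3)]
        index_chain_path_in_star[OF c(2) ab(4)] by blast
  qed
next
  case (word_Gen_Inv e)
  note g = gen_path_in[OF word_Gen_Inv(1)]
  \<comment> \<open>The empty tail of the word leaves a constant path at the end, which is absorbed
    before the inverse law applies.\<close>
  have "homotopic_paths X (gen_path e +++ (reversepath (gen_path e) +++ (\<lambda>_. facet_point (gen_source e))))
      (gen_path e +++ reversepath (gen_path e))"
    using path_in_rid[OF path_in_reversepath[OF g]]
    by (intro path_in_homotopic_join[OF g path_in_join[OF path_in_reversepath[OF g] path_in_const]]
        path_in_refl[OF g]) (use path_in_D[OF g] in auto)
  also have "homotopic_paths X \<dots> (\<lambda>_. facet_point (gen_source e))" by (rule path_in_rinv[OF g])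
  finally show ?case by simp
next
  case (word_Inv_Gen e)
  note g = gen_path_in[OF word_Inv_Gen(1)]
  have "homotopic_paths X (reversepath (gen_path e) +++ (gen_path e +++ (\<lambda>_. facet_point (gen_target e))))
      (reversepath (gen_path e) +++ gen_path e)"
    using path_in_rid[OF g]
    by (intro path_in_homotopic_join[OF path_in_reversepath[OF g] path_in_join[OF g path_in_const]]
        path_in_refl[OF path_in_reversepath[OF g]]) (use path_in_D[OF g] in auto)
  also have "homotopic_paths X \<dots> (\<lambda>_. facet_point (gen_target e))" by (rule path_in_linv[OF g])
  finally show ?case by simp
next
  case (word_refl x w y)
  then show ?case using path_in_refl[OF word_path_in] by blast
next
  case (word_sym x y u v)
  then show ?case by (rule_tac homotopic_paths_sym)
next
  case (word_trans x y u v w)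
  then show ?case by (rule_tac homotopic_paths_trans)
next
  case (word_append x y u u' z v v')
  note w = word_eq_walk[OF word_append(1)] word_eq_walk[OF word_append(2)]
  have "homotopic_paths X (word_path x (u @ v)) (word_path x u +++ word_path y v)"
    by (rule word_path_append[OF w(1,3)])
  also have "homotopic_paths X \<dots> (word_path x u' +++ word_path y v')"
    by (rule path_in_homotopic_join[OF word_path_in[OF w(1)] word_path_in[OF w(3)] word_append.IH])
  also have "homotopic_paths X \<dots> (word_path x (u' @ v'))"
    by (rule homotopic_paths_sym[OF word_path_append[OF w(2,4)]])
  finally show ?case .
qed

section \<open>The functor from words to the fundamental groupoid\<close>

definition realization_functor where
  "realization_functor = (facet_point :: _ \<Rightarrow> real ^ 'n, \<lambda>a b f. {q. \<exists>u\<in>f. homotopic_paths X (word_path a u) q})"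

lemma realization_functor_class:
  assumes "fwalk a u b"
  shows "snd realization_functor a b (word_class SF FG gen_source gen_target FR a b u) = path_class X (word_path a u)"
proof -
  have "homotopic_paths X (word_path a u) q"
    if "fweq a b u v" "homotopic_paths X (word_path a v) q" for v q
    using homotopic_paths_trans[OF word_path_homotopic[OF that(1)] that(2)] .
  moreover have "fweq a b u u" using assms by (rule word_refl)
  ultimately show ?thesis
    unfolding realization_functor_def path_class_def word_class_def snd_conv by blast
qed

lemma is_functor_realization_functor:
  "is_functor (facet_groupoid \<Delta>) (fundamental_groupoid X) realization_functor"
proof -
  have o: "fst realization_functor = facet_point" by (simp add: realization_functor_def)
  have "snd realization_functor a b f \<in> Hom (fundamental_groupoid X) (facet_point a) (facet_point b)"
    if "f \<in> Hom (facet_groupoid \<Delta>) a b" for a b f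
  proof -
    from that obtain u where u: "fwalk a u b" "f = word_class SF FG gen_source gen_target FR a b u"
      unfolding facet_groupoid_def by auto
    show ?thesis unfolding u(2) realization_functor_class[OF u(1)] using word_path_in[OF u(1)] by auto
  qed
  moreover have "snd realization_functor a a (Ident (facet_groupoid \<Delta>) a)
      = Ident (fundamental_groupoid X) (facet_point a)" if "a \<in> SF" for a
    using realization_functor_class[OF walk_Nil[OF that]] unfolding facet_groupoid_def by simp
  moreover have "snd realization_functor a d (Comp (facet_groupoid \<Delta>) a b d g f)
      = Comp (fundamental_groupoid X) (facet_point a) (facet_point b) (facet_point d)
          (snd realization_functor b d g) (snd realization_functor a b f)"
    if "f \<in> Hom (facet_groupoid \<Delta>) a b" "g \<in> Hom (facet_groupoid \<Delta>) b d" for a b d f g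
  proof -
    from that(1) obtain u where u: "fwalk a u b" "f = word_class SF FG gen_source gen_target FR a b u"
      unfolding facet_groupoid_def by auto
    from that(2) obtain v where v: "fwalk b v d" "g = word_class SF FG gen_source gen_target FR b d v"
      unfolding facet_groupoid_def by auto
    show ?thesis
      unfolding facet_groupoid_def u(2) v(2) Comp_presented_groupoid[OF u(1) v(1)]
        realization_functor_class[OF u(1)] realization_functor_class[OF v(1)]
        realization_functor_class[OF walk_append[OF u(1) v(1)]]
        Comp_fundamental_groupoid[OF word_path_in[OF u(1)] word_path_in[OF v(1)]]
      by (rule path_class_eqI[OF word_path_append[OF u(1) v(1)]])
  qed
  moreover have "Obj (facet_groupoid \<Delta>) = SF" unfolding facet_groupoid_def by simp
  ultimately show ?thesis
    unfolding is_functor_def o using facet_point_in_space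
    by (simp del: fundamental_groupoid_simps(2,3))
qed

section \<open>The equivalence\<close>

definition carrier_path :: "real ^ 'n \<Rightarrow> real \<Rightarrow> real ^ 'n" where
  "carrier_path x = linepath (facet_point (carrier_facet x)) x"

lemma facet_point_carrier_in_star:
  assumes "x \<in> star i s"
  shows "facet_point (carrier_facet x) \<in> star i s"
  using facet_point_in_star[of "carrier_facet x" i] carrier_facet_star[OF assms] carrier_facet(1) star_subset assms
  by blast

text \<open>The facet chosen for \<open>x\<close> contains \<open>i\<close> with sign
  \<open>s\<close>, so the segment stays in every star that contains \<open>x\<close>. The
  naturality squares can therefore be filled one star at a time.\<close>

lemma carrier_path_in_star:
  assumes "x \<in> star i s"
  shows "path_in (star i s) (facet_point (carrier_facet x)) (carrier_path x) x"
proof -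
  have x: "x \<in> X" using assms star_subset by blast
  show ?thesis
    unfolding carrier_path_def
    by (rule path_in_star_linepath[OF carrier_facet(1)[OF x]])
      (intro facet_point_in_cone carrier_facet[OF x] facet_point_carrier_in_star assms)+
qed

lemma carrier_path_in: "x \<in> X \<Longrightarrow> path_in X (facet_point (carrier_facet x)) (carrier_path x) x"
  using ex_star path_in_subset[OF carrier_path_in_star star_subset] by blast

lemma small_star: "small A \<longleftrightarrow> (\<exists>i s. A \<subseteq> star i s)"
  unfolding small_def unfolding star_cover_def by blast

lemma subdiv_1_star: "path_image p \<subseteq> star i s \<Longrightarrow> subdiv p 1"
  by (rule subdiv_small_image[of "star i s"]) (auto simp: star_cover_def)

text \<open>The index chosen by \<open>facet_step\<close> may lead through another star. After (R2)
  has replaced it by \<open>i\<close>, both sides run in \<open>star i s\<close> and are homotopic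
  there.\<close>

lemma carrier_path_step:
  assumes "path_in (star i s) x p y"
  shows "homotopic_paths X (word_path (carrier_facet x) (facet_step x y) +++ carrier_path y) (carrier_path x +++ p)"
proof -
  have x: "x \<in> star i s" and y: "y \<in> star i s" using path_in_D[OF assms] by auto
  let ?a = "carrier_facet x" and ?b = "carrier_facet y" and ?u = "[Gen (i, carrier_facet x, carrier_facet y)]"
  note eq = facet_step_gen[OF x y]
  have yX: "y \<in> X" using y star_subset by blast
  have "homotopic_paths X (word_path ?a (facet_step x y) +++ carrier_path y) (word_path ?a ?u +++ carrier_path y)"
    by (rule path_in_homotopic_join[OF word_path_in[OF word_eq_walk(1)[OF eq]] carrier_path_in[OF yX]
          word_path_homotopic[OF eq] path_in_refl[OF carrier_path_in[OF yX]]])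
  also have "homotopic_paths X \<dots> (carrier_path x +++ p)"
  proof (rule star_homotopic)
    have "path_in (star i s) (facet_point ?a) (word_path ?a (map Gen [(i, ?a, ?b)])) (facet_point ?b)"
      by (rule chain_path_in_star) (use carrier_facet_star[OF x] fwalk_single[OF facet_gensI[OF x y]] in auto)
    then show "path_in (star i s) (facet_point ?a) (word_path ?a ?u +++ carrier_path y) y"
      using path_in_join carrier_path_in_star[OF y] by simp
    show "path_in (star i s) (facet_point ?a) (carrier_path x +++ p) y"
      by (rule path_in_join[OF carrier_path_in_star[OF x] assms])
  qed
  finally show ?thesis .
qed

lemma path_in_subpath:
  assumes "path_in X x p y" "u \<in> {0..1}" "v \<in> {0..1}"
  shows "path_in X (p u) (subpath u v p) (p v)"
  using assms path_image_subpath_subset[OF assms(2,3), of p] unfolding path_in_def by auto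

text \<open>Induction over the cells of the grid: the square over each cell is filled inside one
  star, and the squares are pasted along \<open>carrier_path\<close> at the grid points.\<close>

lemma carrier_path_natural:
  assumes "path_in X x p y" "subdiv p n"
  shows "homotopic_paths X (word_path (carrier_facet x) (path_word p n) +++ carrier_path y) (carrier_path x +++ p)"
proof -
  have n: "n > 0" using assms unfolding subdiv_def by simp
  have p: "path p" "path_image p \<subseteq> X" "p 0 = x" "p 1 = y" "x \<in> X"
    using path_in_D[OF assms(1)] by (auto simp: pathstart_def pathfinish_def)
  let ?t = "\<lambda>k. real k / real n" and ?a = "carrier_facet x"
  let ?f = "\<lambda>k. p (?t k)"
  have t: "?t k \<in> {0..1}" if "k \<le> n" for k using that n by (simp add: divide_simps)
  note cx = carrier_path_in[OF p(5)]
  have "homotopic_paths X (word_path ?a (sample_word ?f k) +++ carrier_path (?f k)) (carrier_path x +++ subpath 0 (?t k) p)"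
    if "k \<le> n" for k
    using that
  proof (induction k)
    case 0
    have "homotopic_paths X ((\<lambda>_. facet_point ?a) +++ carrier_path x) (carrier_path x)" by (rule path_in_lid[OF cx])
    also have "homotopic_paths X (carrier_path x) (carrier_path x +++ (\<lambda>_. x))"
      by (rule homotopic_paths_sym[OF path_in_rid[OF cx]])
    finally show ?case using p by (simp add: subpath_refl linepath_refl_eq)
  next
    case (Suc k)
    let ?z = "?f k" and ?w = "?f (Suc k)"
    let ?q = "subpath (?t k) (?t (Suc k)) p" and ?r = "subpath 0 (?t k) p"
    let ?u = "word_path ?a (sample_word ?f k)" and ?s = "word_path (carrier_facet ?z) (facet_step ?z ?w)"
    have k: "k < n" using Suc.prems by simp
    have kk: "k \<le> n" "Suc k \<le> n" using k by auto
    have le: "?t k \<le> ?t (Suc k)" by (simp add: divide_right_mono)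
    obtain i s where st: "p ` {?t k..?t (Suc k)} \<subseteq> star i s"
      using assms(2) k unfolding subdiv_def small_star by blast
    have qs: "path_in (star i s) ?z ?q ?w"
      using p(1) t[OF kk(1)] t[OF kk(2)] st le unfolding path_in_def
      by (simp add: path_image_subpath del: of_nat_Suc)
    note q = path_in_subset[OF qs star_subset]
    have zw: "?z \<in> star i s" "?w \<in> star i s" using path_in_D[OF qs] by auto
    have r: "path_in X x ?r ?z" using path_in_subpath[OF assms(1) _ t[OF kk(1)], of 0] p by simp
    have uw: "fwalk ?a (sample_word ?f k) (carrier_facet ?z)"
    proof -
      have "fwalk (carrier_facet (?f 0)) (sample_word ?f k) (carrier_facet ?z)"
        by (rule sample_word_walk) (use p k subdiv_small[OF assms(2)] in auto)
      then show ?thesis using p by simp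
    qed
    note sw = word_eq_walk(1)[OF facet_step_gen[OF zw]]
    note u = word_path_in[OF uw] and s = word_path_in[OF sw]
    have zX: "?z \<in> X" "?w \<in> X" using zw star_subset by auto
    note cz = carrier_path_in[OF zX(1)] and cw = carrier_path_in[OF zX(2)]
    have "homotopic_paths X (word_path ?a (sample_word ?f k @ facet_step ?z ?w) +++ carrier_path ?w)
        ((?u +++ ?s) +++ carrier_path ?w)"
      by (rule path_in_homotopic_join[OF word_path_in[OF walk_append[OF uw sw]] cw
            word_path_append[OF uw sw] path_in_refl[OF cw]])
    also have "homotopic_paths X \<dots> (?u +++ (?s +++ carrier_path ?w))"
      by (rule homotopic_paths_sym[OF path_in_assoc[OF u s cw]])
    also have "homotopic_paths X \<dots> (?u +++ (carrier_path ?z +++ ?q))"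
      by (rule path_in_homotopic_join[OF u path_in_join[OF s cw] path_in_refl[OF u] carrier_path_step[OF qs]])
    also have "homotopic_paths X \<dots> ((?u +++ carrier_path ?z) +++ ?q)"
      by (rule path_in_assoc[OF u cz q])
    also have "homotopic_paths X \<dots> ((carrier_path x +++ ?r) +++ ?q)"
      by (rule path_in_homotopic_join[OF path_in_join[OF u cz] q Suc.IH[OF kk(1)] path_in_refl[OF q]])
    also have "homotopic_paths X \<dots> (carrier_path x +++ (?r +++ ?q))"
      by (rule homotopic_paths_sym[OF path_in_assoc[OF cx r q]])
    also have "homotopic_paths X \<dots> (carrier_path x +++ subpath 0 (?t (Suc k)) p)"
    proof (rule path_in_homotopic_join[OF cx path_in_join[OF r q] path_in_refl[OF cx]])
      show "homotopic_paths X (?r +++ ?q) (subpath 0 (?t (Suc k)) p)"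
        by (rule homotopic_join_subpaths[OF p(1,2) _ t[OF kk(1)] t[OF kk(2)]]) simp
    qed
    finally show ?case by (simp only: sample_word.simps)
  qed
  from this[of n] show ?thesis using n p unfolding path_word_def by simp
qed

lemma isomorphism_in_fundamental_groupoid:
  assumes "path_in X x p y"
  shows "isomorphism_in (fundamental_groupoid X) x y (path_class X p)"
  by (rule groupoid.all_iso[OF groupoid_fundamental_groupoid]) (use assms path_in_D[OF assms] in auto)

lemma word_realization_natural:
  "naturally_isomorphic (fundamental_groupoid X) (fundamental_groupoid X)
     (comp_functor realization_functor word_functor) id_functor"
proof -
  have o: "fst (comp_functor realization_functor word_functor) x = facet_point (carrier_facet x)" for x
    by (simp add: comp_functor_def realization_functor_def word_functor_def)
  have h: "snd (comp_functor realization_functor word_functor) x y f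
      = snd realization_functor (carrier_facet x) (carrier_facet y) (snd word_functor x y f)" for x y f
    by (simp add: comp_functor_def word_functor_def)
  have i: "fst id_functor x = x" "snd id_functor x y f = f" for x y f
    by (simp_all add: id_functor_def)
  have "Comp (fundamental_groupoid X) (facet_point (carrier_facet x)) (facet_point (carrier_facet y)) y
        (path_class X (carrier_path y))
        (snd realization_functor (carrier_facet x) (carrier_facet y) (snd word_functor x y f))
      = Comp (fundamental_groupoid X) (facet_point (carrier_facet x)) x y f (path_class X (carrier_path x))"
    if "f \<in> Hom (fundamental_groupoid X) x y" for x y f
  proof -
    from that obtain p where p: "path_in X x p y" "f = path_class X p" by auto
    obtain n where n: "subdiv p n" using ex_subdiv path_in_D[OF p(1)] by blast
    note w = path_word_walk[OF p(1) n]
    have xy: "x \<in> X" "y \<in> X" using path_in_D[OF p(1)] by auto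
    show ?thesis
      unfolding p(2) word_functor_class[OF p(1) n] realization_functor_class[OF w]
        Comp_fundamental_groupoid[OF word_path_in[OF w] carrier_path_in[OF xy(2)]]
        Comp_fundamental_groupoid[OF carrier_path_in[OF xy(1)] p(1)]
      by (rule path_class_eqI[OF carrier_path_natural[OF p(1) n]])
  qed
  then show ?thesis
    unfolding naturally_isomorphic_def o h i
    using isomorphism_in_fundamental_groupoid[OF carrier_path_in]
    by (intro exI[of _ "\<lambda>x. path_class X (carrier_path x)"]) (simp del: fundamental_groupoid_simps(2))
qed

text \<open>A relation between paths and words in place of an application of
  \<open>word_functor\<close>: realizations of words can be treated letter by letter and up to
  homotopy, without carrying a common grid along.\<close>

definition represents where
  "represents x p y u \<longleftrightarrow> path_in X x p y \<and>
     (\<exists>n. subdiv p n \<and> fweq (carrier_facet x) (carrier_facet y) (path_word p n) u)"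

text \<open>The grid is existential in \<open>represents\<close>; since words on different grids are
  equivalent, every grid serves.\<close>

lemma representsD:
  assumes "represents x p y u" "subdiv p n"
  shows "fweq (carrier_facet x) (carrier_facet y) (path_word p n) u"
proof -
  obtain m where m: "path_in X x p y" "subdiv p m" "fweq (carrier_facet x) (carrier_facet y) (path_word p m) u"
    using assms(1) unfolding represents_def by blast
  show ?thesis by (rule word_trans[OF path_word_unique[OF m(1) assms(2) m(2)] m(3)])
qed

lemma represents_join:
  assumes "represents x p y u" "represents y q z v"
  shows "represents x (p +++ q) z (u @ v)"
proof -
  have p: "path_in X x p y" and q: "path_in X y q z" using assms unfolding represents_def by auto
  obtain n m where nm: "subdiv p n" "subdiv q m" using assms unfolding represents_def by blast
  then have "n > 0" "m > 0" unfolding subdiv_def by auto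
  with nm have f: "subdiv p (n * m)" "subdiv q (n * m)"
    using subdiv_mult[of p n m] subdiv_mult[of q m n] by (simp_all add: mult.commute)
  note j = path_word_join[OF p q f]
  have "fweq (carrier_facet x) (carrier_facet z) (path_word (p +++ q) (n * m + n * m)) (u @ v)"
    unfolding j(2) by (rule word_append[OF representsD[OF assms(1) f(1)] representsD[OF assms(2) f(2)]])
  then show ?thesis
    unfolding represents_def using path_in_join[OF p q] j(1) by blast
qed

lemma represents_homotopic:
  assumes "represents x p y u" "homotopic_paths X p q"
  shows "represents x q y u"
proof -
  obtain n where p: "path_in X x p y" "subdiv p n"
    and u: "fweq (carrier_facet x) (carrier_facet y) (path_word p n) u"
    using assms unfolding represents_def by blast
  have q: "path_in X x q y" using path_in_homotopic[OF p(1) assms(2)] .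
  obtain m where m: "subdiv q m" using ex_subdiv path_in_D[OF q] by blast
  show ?thesis
    unfolding represents_def
    using q m word_trans[OF word_sym[OF path_word_homotopic[OF p(1) assms(2) p(2) m]] u] by blast
qed

lemma subdiv_const:
  assumes "x \<in> X"
  shows "subdiv (\<lambda>_. x) 1"
proof -
  obtain i s where "x \<in> star i s" using ex_star[OF assms] by blast
  then show ?thesis by (intro subdiv_1_star[of _ i s]) (auto simp: path_image_def)
qed

lemma represents_const:
  assumes "x \<in> X"
  shows "represents x (\<lambda>_. x) x []"
  unfolding represents_def
proof (intro conjI exI)
  show "fweq (carrier_facet x) (carrier_facet x) (path_word (\<lambda>_. x) 1) []"
    unfolding path_word_1 by (rule step_refl[OF assms])
qed (rule path_in_const[OF assms] subdiv_const[OF assms])+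

text \<open>The grid is not reversed. Instead, the reversed path followed by the path is a
  null-homotopic loop, so any word of the reversed path becomes trivial when followed by
  \<open>u\<close>, and only the inverse of \<open>u\<close> does that.\<close>

lemma represents_reversepath:
  assumes "represents x p y u"
  shows "represents y (reversepath p) x (inverse_word u)"
proof -
  have p: "path_in X x p y" using assms unfolding represents_def by blast
  note r = path_in_reversepath[OF p]
  have xy: "x \<in> X" "y \<in> X" using path_in_D[OF p] by auto
  obtain m where m: "subdiv (reversepath p) m" using ex_subdiv path_in_D[OF r] by blast
  let ?r = "path_word (reversepath p) m" and ?x = "carrier_facet x" and ?y = "carrier_facet y"
  have wr: "fwalk ?y ?r ?x" by (rule path_word_walk[OF r m])
  have wu: "fwalk ?x u ?y" using word_eq_walk(2)[OF representsD[OF assms]] assms unfolding represents_def by blast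
  have "represents y (reversepath p) x ?r"
    unfolding represents_def using r m word_refl[OF wr] by blast
  from represents_homotopic[OF represents_join[OF this assms] path_in_linv[OF p]]
  have "fweq ?y ?y (path_word (\<lambda>_. y) 1) (?r @ u)"
    by (rule representsD) (rule subdiv_const[OF xy(2)])
  from word_trans[OF word_sym[OF this], of "[]"] have ru: "fweq ?y ?y (?r @ u) []"
    using step_refl[OF xy(2)] unfolding path_word_1 by blast
  \<comment> \<open>The word \<open>?r @ u @ inverse_word u\<close> is simplified in two ways, from
    the right and from the left.\<close>
  have 1: "fweq ?y ?x (?r @ u @ inverse_word u) (?r @ [])"
    by (rule word_append[OF word_refl[OF wr] word_eq_right_inverse[OF wu]])
  have 2: "fweq ?y ?x ((?r @ u) @ inverse_word u) ([] @ inverse_word u)"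
    by (rule word_append[OF ru word_refl[OF walk_inverse_word[OF wu]]])
  have "fweq ?y ?x ?r (inverse_word u)"
    using word_trans[OF word_sym[OF 1]] 2 by simp
  then show ?thesis unfolding represents_def using r m by blast
qed

text \<open>The path lies in one star, so a grid with a single cell suffices and yields a single
  step. The facet points return \<open>a\<close> and \<open>b\<close>, and (R2) corrects the chosen
  index to \<open>i\<close>.\<close>

lemma represents_gen_path:
  assumes "e \<in> FG"
  shows "represents (facet_point (gen_source e)) (gen_path e) (facet_point (gen_target e)) [Gen e]"
proof -
  obtain i a b where e: "e = (i, a, b)" using prod_cases3 by blast
  have g: "(i, a, b) \<in> FG" using assms e by simp
  have ab: "a \<in> SF" "b \<in> SF" using g unfolding facet_gens_def by auto
  note st = gen_path_in_star[OF g]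
  have pq: "gen_path (i, a, b) 0 = facet_point a" "gen_path (i, a, b) 1 = facet_point b"
    using path_in_D[OF st] unfolding pathstart_def pathfinish_def by auto
  have "fweq (carrier_facet (facet_point a)) (carrier_facet (facet_point b)) (facet_step (facet_point a) (facet_point b))
      [Gen (i, carrier_facet (facet_point a), carrier_facet (facet_point b))]"
    by (rule facet_step_gen) (rule path_in_D[OF st])+
  then have "fweq (carrier_facet (facet_point a)) (carrier_facet (facet_point b)) (path_word (gen_path (i, a, b)) 1) [Gen (i, a, b)]"
    unfolding path_word_1 pq unfolding carrier_facet_point[OF ab(1)] carrier_facet_point[OF ab(2)] .
  moreover have "subdiv (gen_path (i, a, b)) 1"
    by (rule subdiv_1_star) (rule path_in_D[OF st])
  ultimately show ?thesis
    using path_in_subset[OF st star_subset] unfolding e represents_def fst_conv snd_conv by blast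
qed

lemma represents_word_path:
  "fwalk a w b \<Longrightarrow> represents (facet_point a) (word_path a w) (facet_point b) w"
proof (induction rule: walk.induct)
  case (walk_Nil x)
  then show ?case using represents_const facet_point_in_space by simp
next
  case (walk_Gen e w y)
  then show ?case using represents_join[OF represents_gen_path] by fastforce
next
  case (walk_Inv e w y)
  have "represents (facet_point (gen_target e)) (reversepath (gen_path e)) (facet_point (gen_source e)) [Inv e]"
    using represents_reversepath[OF represents_gen_path[OF walk_Inv(1)]] by (simp add: inverse_word_def)
  then show ?case using represents_join[OF _ walk_Inv(4)] by fastforce
qed

text \<open>On this side the composite is the identity on the nose: facet points return their own
  signed facets, and sampling the realization of a word gives back its class by
  \<open>represents_word_path\<close>.\<close>

lemma realization_word_natural:
  "naturally_isomorphic (facet_groupoid \<Delta>) (facet_groupoid \<Delta>)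
     (comp_functor word_functor realization_functor) id_functor"
proof (rule naturally_isomorphic_id_functor)
  show "category (facet_groupoid \<Delta>)"
    unfolding facet_groupoid_def using groupoid_presented_groupoid unfolding groupoid_def by blast
next
  fix a assume "a \<in> Obj (facet_groupoid \<Delta>)"
  then show "fst (comp_functor word_functor realization_functor) a = a"
    using carrier_facet_point unfolding facet_groupoid_def comp_functor_def realization_functor_def word_functor_def
    by simp
next
  fix a b f assume ab: "a \<in> Obj (facet_groupoid \<Delta>)" "b \<in> Obj (facet_groupoid \<Delta>)"
    and "f \<in> Hom (facet_groupoid \<Delta>) a b"
  then obtain u where u: "fwalk a u b" "f = word_class SF FG gen_source gen_target FR a b u"
    unfolding facet_groupoid_def by auto
  note p = word_path_in[OF u(1)]
  obtain n where n: "subdiv (word_path a u) n" using ex_subdiv path_in_D[OF p] by blast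
  have c: "carrier_facet (facet_point a) = a" "carrier_facet (facet_point b) = b"
    using ab carrier_facet_point unfolding facet_groupoid_def by auto
  have "snd (comp_functor word_functor realization_functor) a b f
      = snd word_functor (facet_point a) (facet_point b) (snd realization_functor a b f)"
    by (simp add: comp_functor_def realization_functor_def)
  also have "\<dots> = word_class SF FG gen_source gen_target FR a b (path_word (word_path a u) n)"
    unfolding u(2) realization_functor_class[OF u(1)] word_functor_class[OF p n] c ..
  also have "\<dots> = f"
    using word_class_eqI[OF representsD[OF represents_word_path[OF u(1)] n]] unfolding c u(2) .
  finally show "snd (comp_functor word_functor realization_functor) a b f = f" .
qed

end

theorem theorem5p1p1:
  fixes \<Delta> :: "'n::finite set set"
  assumes "abstract_simplicial_complex UNIV \<Delta>"
  shows "equivalent_groupoids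
           (fundamental_groupoid (real_punctured_spectrum \<Delta>))
           (facet_groupoid \<Delta>)"
proof -
  interpret simplicial_complex \<Delta> by unfold_locales fact
  have "groupoid (facet_groupoid \<Delta>)"
    unfolding facet_groupoid_def by (rule groupoid_presented_groupoid)
  moreover have "is_functor (fundamental_groupoid X) (facet_groupoid \<Delta>) word_functor"
    unfolding facet_groupoid_def by (rule is_functor_word_functor)
  ultimately show ?thesis
    unfolding equivalent_groupoids_def
    using groupoid_fundamental_groupoid is_functor_realization_functor
      word_realization_natural realization_word_natural by blast
qed

end
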